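(* Under the setting below, $G_\infty$ is a plane $2$-spanner of the visibility graph $\mathrm{Vis}(V,S)$.
   Context: Setting: $V$ is a finite set of points (vertices) in the plane and $S$ a finite set of simple polygonal obstacles, pairwise non-intersecting, all of whose corners lie in $V$; each vertex is a corner of at most one obstacle and occurs at most once on its boundary. General position: no three vertices collinear and no two vertices on a line parallel to a cone boundary ray. Points $p,q$ are visible if segment $pq$ does not properly intersect any obstacle (touching at vertices or running along boundaries is allowed, meeting an obstacle interior is not). $\mathrm{Vis}(V,S)$ is the graph on $V$ with an edge for every visible pair, weighted by Euclidean length. For a graph $G$, $d_G(x,y)$ is the length of a shortest $x$–$y$ path; a subgraph $H$ of $G$ on the same vertex set is a $t$-spanner of $G$ if $d_H(x,y)\le t\,d_G(x,y)$ for all $x,y$. Plane means no two edges properly cross. Cones: around each vertex $u$ the plane is partitioned into six cones of angle $\pi/3$ with apex $u$; $C_0^u$ has the upward vertical bisector, and counterclockwise the cones are $C_0^u,\overline{C_2^u},C_1^u,\overline{C_0^u},C_2^u,\overline{C_1^u}$ (positive cones $C_i$, negative cones $\overline{C_i}$). If the obstacle having $u$ as a corner splits a cone so that there are vertices visible from $u$ on both sides of the obstacle within it, the cone is regarded as two subcones; otherwise a single subcone. $G_\infty$: for every vertex $u$ and every positive subcone of $u$, add an edge from $u$ to the vertex visible from $u$ in that subcone whose orthogonal projection onto the cone's bisector is closest to $u$. *)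

theory Defs
  imports "HOL-Analysis.Analysis" "HOL-Library.Extended_Real"
begin

type_synonym pt = "real \<times> real"

definition poly_edge :: "pt list \<Rightarrow> nat \<Rightarrow> pt \<times> pt" where
  "poly_edge P k = (P ! k, P ! ((k + 1) mod length P))"

definition poly_boundary :: "pt list \<Rightarrow> pt set" where
  "poly_boundary P = (\<Union>k<length P. closed_segment (fst (poly_edge P k)) (snd (poly_edge P k)))"

definition simple_polygon :: "pt list \<Rightarrow> bool" where
  "simple_polygon P \<longleftrightarrow> length P \<ge> 3 \<and> distinct P \<and>
     (\<forall>i<length P. \<forall>j<length P. i \<noteq> j \<longrightarrow>
        closed_segment (fst (poly_edge P i)) (snd (poly_edge P i)) \<inter>
        closed_segment (fst (poly_edge P j)) (snd (poly_edge P j)) =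
          (if j = (i + 1) mod length P then {P ! j}
           else if i = (j + 1) mod length P then {P ! i} else {}))"

definition obst_interior :: "pt list \<Rightarrow> pt set" where
  "obst_interior P = inside (poly_boundary P)"

definition obst_region :: "pt list \<Rightarrow> pt set" where
  "obst_region P = poly_boundary P \<union> obst_interior P"

definition valid_setting :: "pt set \<Rightarrow> pt list set \<Rightarrow> bool" where
  "valid_setting V S \<longleftrightarrow> finite V \<and> finite S \<and>
     (\<forall>P\<in>S. simple_polygon P \<and> set P \<subseteq> V) \<and>
     (\<forall>P\<in>S. \<forall>Q\<in>S. P \<noteq> Q \<longrightarrow> obst_region P \<inter> obst_region Q = {}) \<and>
     (\<forall>P\<in>S. \<forall>Q\<in>S. P \<noteq> Q \<longrightarrow> set P \<inter> set Q = {})"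

text \<open>General position: no three vertices collinear, and no two vertices on a line parallel
  to a cone boundary ray (directions 0, 60 and 120 degrees).\<close>
definition general_position :: "pt set \<Rightarrow> bool" where
  "general_position V \<longleftrightarrow>
     (\<forall>a\<in>V. \<forall>b\<in>V. \<forall>c\<in>V. a \<noteq> b \<and> a \<noteq> c \<and> b \<noteq> c \<longrightarrow> \<not> collinear {a, b, c}) \<and>
     (\<forall>a\<in>V. \<forall>b\<in>V. a \<noteq> b \<longrightarrow>
        snd b - snd a \<noteq> 0 \<and>
        snd b - snd a \<noteq> sqrt 3 * (fst b - fst a) \<and>
        snd b - snd a \<noteq> - sqrt 3 * (fst b - fst a))"

definition visible :: "pt list set \<Rightarrow> pt \<Rightarrow> pt \<Rightarrow> bool" where
  "visible S p q \<longleftrightarrow> (\<forall>P\<in>S. closed_segment p q \<inter> obst_interior P = {})"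

text \<open>Graphs on the vertex set are given by their (undirected) edge sets, as sets of pairs.\<close>
definition Vis :: "pt set \<Rightarrow> pt list set \<Rightarrow> (pt \<times> pt) set" where
  "Vis V S = {(p, q). p \<in> V \<and> q \<in> V \<and> p \<noteq> q \<and> visible S p q}"

definition adj :: "(pt \<times> pt) set \<Rightarrow> pt \<Rightarrow> pt \<Rightarrow> bool" where
  "adj E a b \<longleftrightarrow> (a, b) \<in> E \<or> (b, a) \<in> E"

definition walks :: "(pt \<times> pt) set \<Rightarrow> pt \<Rightarrow> pt \<Rightarrow> pt list set" where
  "walks E x y = {ps. ps \<noteq> [] \<and> hd ps = x \<and> last ps = y \<and>
                      (\<forall>k. Suc k < length ps \<longrightarrow> adj E (ps ! k) (ps ! Suc k))}"

definition walk_len :: "pt list \<Rightarrow> real" where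
  "walk_len ps = (\<Sum>k<length ps - 1. dist (ps ! k) (ps ! Suc k))"

text \<open>Shortest path distance with Euclidean edge weights (infinite if no path).\<close>
definition gdist :: "(pt \<times> pt) set \<Rightarrow> pt \<Rightarrow> pt \<Rightarrow> ereal" where
  "gdist E x y = (INF ps \<in> walks E x y. ereal (walk_len ps))"

definition is_spanner :: "real \<Rightarrow> pt set \<Rightarrow> (pt \<times> pt) set \<Rightarrow> (pt \<times> pt) set \<Rightarrow> bool" where
  "is_spanner t V H G \<longleftrightarrow> H \<subseteq> G \<and>
     (\<forall>x\<in>V. \<forall>y\<in>V. gdist H x y \<le> ereal t * gdist G x y)"

definition plane :: "(pt \<times> pt) set \<Rightarrow> bool" where
  "plane E \<longleftrightarrow> (\<forall>(a, b)\<in>E. \<forall>(c, d)\<in>E. {a, b} \<noteq> {c, d} \<longrightarrow>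
                  open_segment a b \<inter> open_segment c d = {})"

text \<open>Bisector directions of the positive cones C_0 (90 deg), C_1 (210 deg), C_2 (330 deg).\<close>
definition bisector :: "nat \<Rightarrow> pt" where
  "bisector i = (if i = 0 then (0, 1) else if i = 1 then (- sqrt 3 / 2, - 1 / 2)
                 else (sqrt 3 / 2, - 1 / 2))"

definition proj :: "nat \<Rightarrow> pt \<Rightarrow> pt \<Rightarrow> real" where
  "proj i u v = (fst v - fst u) * fst (bisector i) + (snd v - snd u) * snd (bisector i)"

text \<open>Positive cone C_i with apex u: points whose direction from u makes an angle of at most
  pi/6 with the bisector (boundaries are irrelevant under general position).\<close>
definition in_cone :: "nat \<Rightarrow> pt \<Rightarrow> pt \<Rightarrow> bool" where
  "in_cone i u v \<longleftrightarrow> v \<noteq> u \<and> proj i u v \<ge> sqrt 3 / 2 * dist u v"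

definition vis_in_cone :: "pt set \<Rightarrow> pt list set \<Rightarrow> nat \<Rightarrow> pt \<Rightarrow> pt set" where
  "vis_in_cone V S i u = {v \<in> V. in_cone i u v \<and> visible S u v}"

definition sector :: "pt \<Rightarrow> pt \<Rightarrow> pt \<Rightarrow> pt set" where
  "sector u v w = {u + s *\<^sub>R (v - u) + t *\<^sub>R (w - u) | s t. s \<ge> 0 \<and> t \<ge> 0}"

text \<open>Two vertices visible from u in the same cone lie in the same subcone unless the obstacle
  having u as a corner lies (locally at u) between them, i.e. its interior meets the angular
  sector spanned by them in every neighbourhood of u.\<close>
definition same_subcone :: "pt list set \<Rightarrow> pt \<Rightarrow> pt \<Rightarrow> pt \<Rightarrow> bool" where
  "same_subcone S u v w \<longleftrightarrow>
     \<not> (\<exists>P\<in>S. u \<in> set P \<and> u \<in> closure (sector u v w \<inter> obst_interior P))"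

definition Ginf :: "pt set \<Rightarrow> pt list set \<Rightarrow> (pt \<times> pt) set" where
  "Ginf V S = {(u, v). u \<in> V \<and> (\<exists>i<3. v \<in> vis_in_cone V S i u \<and>
       (\<forall>w \<in> vis_in_cone V S i u. same_subcone S u v w \<longrightarrow> proj i u v \<le> proj i u w))}"

end

theory Submission
  imports Defs
begin

text \<open>By general position and the Jordan curve theorem, a visible segment between two vertices is
  never crossed by an obstacle edge. Hence, if a ray is rotated inside a triangle from one visible
  side until it first hits a vertex, the swept area meets no obstacle. This has two consequences.
  If two visible segments \<open>u w\<close> and \<open>v x\<close> cross at \<open>y\<close>, then \<open>u\<close> sees a vertex of the triangle
  \<open>u y x\<close> in the subcone of \<open>w\<close>; for two crossing edges of \<open>Ginf\<close> such a vertex is always closer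
  than the endpoint of one of them, so the graph is plane. And from the vertex \<open>v\<close> closest to \<open>u\<close>
  in the subcone of a visible \<open>w\<close>, a convex chain of visible segments inside the triangle \<open>u v w\<close>
  leads to \<open>w\<close>. By induction on the size of the equilateral triangle with apex \<open>u\<close> and with \<open>w\<close> on
  the opposite side, each chain segment is replaced by a path that is not longer than one of the two
  routes along the sides of its own triangle, namely the route prescribed by an empty half of that
  triangle where there is one. These bounds add up to one of the two routes from \<open>u\<close> to \<open>w\<close>, and
  such a route is at most twice as long as the segment \<open>u w\<close>.\<close>

section \<open>Simple polygons\<close>

text \<open>Bounding every chain segment by the longer of its two routes cannot work, since a sum of
  maxima may exceed the maximum of the sums. Hence the induction also bounds a prescribed route
  whenever the half of the triangle away from that route is empty. The half containing the closest
  vertex leaves nothing to prove. For a chain segment, emptiness comes from the swept triangle or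
  from emptiness in the larger triangle; where neither is available, the slope of the segment
  decides which route is longer. The chain turns one way only, so segments charged to one route
  precede those charged to the other, and the vertex at which the charge changes lies so that the
  change costs nothing. The constants come from oblique coordinates. If \<open>A\<close> and
  \<open>B\<close> are the distances of \<open>w\<close> from the lines bounding the cone at
  \<open>u\<close>, the triangle has height \<open>A + B\<close> and its routes have lengths
  \<open>2 / sqrt 3\<close> times \<open>2 * A + B\<close> and \<open>A + 2 * B\<close>. Three times
  the squared length of \<open>u w\<close> is \<open>4 * (A * A + A * B + B * B)\<close>, which
  bounds the square of either sum and gives the factor 2.\<close>

definition cross2 :: "pt \<Rightarrow> pt \<Rightarrow> real" where
  "cross2 x y = fst x * snd y - snd x * fst y"

lemma collinear_if_cross2_eq_0:
  assumes "cross2 (b - a) (c - a) = 0"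
  shows "collinear {a, b, c}"
proof (cases "b = a")
  case True
  then show ?thesis by simp
next
  case False
  define n where "n = (norm (b - a))\<^sup>2"
  have n: "n = (fst b - fst a)\<^sup>2 + (snd b - snd a)\<^sup>2"
    unfolding n_def by (simp add: norm_prod_def)
  have n0: "n > 0" using False by (simp add: n_def)
  \<comment> \<open>\<open>k\<close> is the coefficient of the orthogonal projection of
    \<open>c - a\<close> onto \<open>b - a\<close>; parallelism makes the projection exact.\<close>
  define k where "k = ((fst b - fst a) * (fst c - fst a) + (snd b - snd a) * (snd c - snd a)) / n"
  have eq: "(fst b - fst a) * (snd c - snd a) = (snd b - snd a) * (fst c - fst a)"
    using assms by (simp add: cross2_def)
  have "n * (fst c - fst a) = n * (k * (fst b - fst a))"
    unfolding k_def using n0 eq by (simp add: n power2_eq_square) algebra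
  moreover have "n * (snd c - snd a) = n * (k * (snd b - snd a))"
    unfolding k_def using n0 eq by (simp add: n power2_eq_square) algebra
  ultimately have "c - a = k *\<^sub>R (b - a)"
    using n0 by (simp add: prod_eq_iff)
  then have "c = (1 - k) *\<^sub>R a + (1 - (1 - k)) *\<^sub>R b"
    by (simp add: algebra_simps)
  then have "collinear {a, c, b}"
    by (metis collinear_3_expand)
  then show ?thesis by (simp add: insert_commute)
qed

text \<open>Each new edge meets the path built so far only at its starting corner. The closing edge
  stays out, as it would also return to \<open>P ! 0\<close>.\<close>

lemma simple_polygon_arc:
  assumes "simple_polygon P" "1 \<le> k" "k < length P"
  shows "\<exists>g. arc g \<and> pathstart g = P ! 0 \<and> pathfinish g = P ! k \<and>
             path_image g = (\<Union>i<k. closed_segment (P ! i) (P ! Suc i))"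
  using assms(2,3)
proof (induction k rule: nat_induct_at_least)
  case base
  have "length P \<ge> 3" "distinct P" using assms(1) by (simp_all add: simple_polygon_def)
  then have "P ! 0 \<noteq> P ! 1"
    by (subst nth_eq_iff_index_eq) auto
  then show ?case
    by (intro exI[of _ "linepath (P ! 0) (P ! 1)"]) auto
next
  case (Suc k)
  then obtain g where g: "arc g" "pathstart g = P ! 0" "pathfinish g = P ! k"
    "path_image g = (\<Union>i<k. closed_segment (P ! i) (P ! Suc i))" by auto
  have ne: "P ! k \<noteq> P ! Suc k"
    using assms(1) Suc.prems by (auto simp: simple_polygon_def nth_eq_iff_index_eq)
  have "closed_segment (P ! i) (P ! Suc i) \<inter> closed_segment (P ! k) (P ! Suc k) \<subseteq> {P ! k}"
    if "i < k" for i
  proof -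
    have "closed_segment (fst (poly_edge P i)) (snd (poly_edge P i)) \<inter>
        closed_segment (fst (poly_edge P k)) (snd (poly_edge P k)) =
          (if k = (i + 1) mod length P then {P ! k}
           else if i = (k + 1) mod length P then {P ! i} else {})"
      using assms(1) that Suc.prems unfolding simple_polygon_def by auto
    then show ?thesis
      using that Suc.prems by (auto simp: poly_edge_def split: if_splits)
  qed
  then have "path_image g \<inter> path_image (linepath (P ! k) (P ! Suc k)) \<subseteq> {P ! k}"
    unfolding g(4) by auto
  then have "arc (g +++ linepath (P ! k) (P ! Suc k))"
    using g ne by (intro arc_join) auto
  moreover have "path_image (g +++ linepath (P ! k) (P ! Suc k)) =
      (\<Union>i<Suc k. closed_segment (P ! i) (P ! Suc i))"
    using g by (subst path_image_join) (auto simp: lessThan_Suc)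
  ultimately show ?case using g by (intro exI[of _ "g +++ linepath (P ! k) (P ! Suc k)"]) auto
qed

lemma simple_polygon_loop:
  assumes "simple_polygon P"
  obtains c where "simple_path c" "pathfinish c = pathstart c" "path_image c = poly_boundary P"
proof -
  define n where "n = length P"
  have n: "n \<ge> 3" "distinct P" using assms by (auto simp: simple_polygon_def n_def)
  have "1 \<le> n - 1" "n - 1 < length P" using n(1) by (auto simp: n_def)
  then obtain g where g: "arc g" "pathstart g = P ! 0" "pathfinish g = P ! (n - 1)"
    "path_image g = (\<Union>i<n - 1. closed_segment (P ! i) (P ! Suc i))"
    using simple_polygon_arc[OF assms] by blast
  let ?h = "linepath (P ! (n - 1)) (P ! 0)"
  have ne: "P ! (n - 1) \<noteq> P ! 0"
    using n by (subst nth_eq_iff_index_eq) (auto simp: n_def)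
  have "closed_segment (P ! i) (P ! Suc i) \<inter> closed_segment (P ! (n - 1)) (P ! 0) \<subseteq> {P ! 0, P ! (n - 1)}"
    if "i < n - 1" for i
  proof -
    have "closed_segment (fst (poly_edge P i)) (snd (poly_edge P i)) \<inter>
        closed_segment (fst (poly_edge P (n - 1))) (snd (poly_edge P (n - 1))) =
          (if n - 1 = (i + 1) mod length P then {P ! (n - 1)}
           else if i = ((n - 1) + 1) mod length P then {P ! i} else {})"
      using assms that n unfolding simple_polygon_def n_def[symmetric] by auto
    then show ?thesis
      using that n by (auto simp: poly_edge_def n_def[symmetric] split: if_splits)
  qed
  then have "path_image g \<inter> path_image ?h \<subseteq> {P ! 0, P ! (n - 1)}"
    unfolding g(4) by auto
  then have "simple_path (g +++ ?h)"
    using g ne by (intro simple_path_join_loop) auto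
  moreover have "path_image (g +++ ?h) = poly_boundary P"
  proof -
    have "{..<n} = insert (n - 1) {..<n - 1}" using n by auto
    moreover have "(n - 1 + 1) mod n = 0" using n by auto
    ultimately show ?thesis
      using g n by (subst path_image_join) (auto simp: poly_boundary_def poly_edge_def n_def[symmetric])
  qed
  moreover have "pathfinish (g +++ ?h) = pathstart (g +++ ?h)"
    using g by simp
  ultimately show ?thesis using that by blast
qed

text \<open>A Jordan curve is the frontier of its inside. This turns contact with an obstacle edge
  into contact with interior points nearby.\<close>

lemma poly_boundary_subset_closure_interior:
  assumes "simple_polygon P"
  shows "poly_boundary P \<subseteq> closure (obst_interior P)"
proof -
  obtain c where c: "simple_path c" "pathfinish c = pathstart c" "path_image c = poly_boundary P"
    using simple_polygon_loop[OF assms] .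
  \<comment> \<open>The Jordan curve theorem of the library is about the complex plane.\<close>
  define h :: "pt \<Rightarrow> complex" where "h = (\<lambda>x. Complex (fst x) (snd x))"
  define k :: "complex \<Rightarrow> pt" where "k = (\<lambda>z. (Re z, Im z))"
  have kh: "k (h x) = x" and hk: "h (k z) = z" for x z
    by (simp_all add: h_def k_def)
  have h: "bounded_linear h"
    unfolding h_def
    by (intro linear_conv_bounded_linear[THEN iffD1] linearI) (auto simp: complex_eq_iff)
  have k: "bounded_linear k"
    unfolding k_def
    by (intro linear_conv_bounded_linear[THEN iffD1] linearI) auto
  define B where "B = path_image (h \<circ> c)"
  have B: "B = h ` poly_boundary P" using c(3) by (simp add: B_def path_image_compose)
  have "inj h" using kh by (metis injI)
  then have "simple_path (h \<circ> c)"
    using c(1) h by (simp add: simple_path_linear_image_eq bounded_linear.linear)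
  moreover have "pathfinish (h \<circ> c) = pathstart (h \<circ> c)"
    using c(2) by (simp add: pathfinish_def pathstart_def)
  ultimately have fr: "B \<subseteq> closure (inside B)"
    using Jordan_inside_outside[of "h \<circ> c"] by (auto simp: B_def frontier_def)
  have "k ` inside B \<subseteq> obst_interior P"
  proof
    fix x assume "x \<in> k ` inside B"
    then obtain z where z: "x = k z" "z \<notin> B" "bounded (connected_component_set (- B) z)"
      by (auto simp: inside_def)
    let ?C = "connected_component_set (- poly_boundary P) x"
    have xn: "x \<notin> poly_boundary P" using z(1,2) hk[of z] by (metis B imageI)
    have "connected (h ` ?C)"
      using h by (intro connected_continuous_image) (auto intro: linear_continuous_on)
    moreover have "z \<in> h ` ?C"
      using z(1) hk[of z] xn by (intro image_eqI[of _ _ x]) auto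
    moreover have "h ` ?C \<subseteq> - B"
      unfolding B by (metis \<open>inj h\<close> connected_component_subset image_mono inj_image_Compl_subset order_trans)
    ultimately have "h ` ?C \<subseteq> connected_component_set (- B) z"
      by (intro connected_component_maximal)
    then have "bounded (k ` h ` ?C)"
      using z(3) k by (meson bounded_linear_image bounded_subset)
    then have "bounded ?C" by (simp add: image_image kh)
    then show "x \<in> obst_interior P"
      using xn by (simp add: obst_interior_def inside_def)
  qed
  then have "closure (k ` inside B) \<subseteq> closure (obst_interior P)"
    by (rule closure_mono)
  moreover have "k ` closure (inside B) \<subseteq> closure (k ` inside B)"
    using k by (intro image_closure_subset) (auto intro: linear_continuous_on closure_subset[THEN subsetD])
  moreover have "poly_boundary P = k ` B" by (simp add: B image_image kh)
  ultimately show ?thesis using fr by blast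
qed

lemma compact_poly_boundary: "compact (poly_boundary P)"
  unfolding poly_boundary_def by (intro compact_UN) auto

lemma open_obst_interior: "open (obst_interior P)"
  unfolding obst_interior_def by (simp add: compact_poly_boundary compact_imp_closed open_inside)

lemma connected_subset_obst_interior:
  assumes "connected C" "C \<inter> poly_boundary P = {}" "x \<in> C" "x \<in> obst_interior P"
  shows "C \<subseteq> obst_interior P"
proof
  fix y assume "y \<in> C"
  then have "connected_component (- poly_boundary P) x y"
    unfolding connected_component_def using assms by blast
  then show "y \<in> obst_interior P"
    using assms(4) inside_same_component unfolding obst_interior_def by blast
qed

section \<open>Determinants and half-planes\<close>

lemma cross2_add_left: "cross2 (x + y) z = cross2 x z + cross2 y z"
  and cross2_add_right: "cross2 z (x + y) = cross2 z x + cross2 z y"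
  and cross2_diff_left: "cross2 (x - y) z = cross2 x z - cross2 y z"
  and cross2_diff_right: "cross2 z (x - y) = cross2 z x - cross2 z y"
  and cross2_scale_left: "cross2 (r *\<^sub>R x) z = r * cross2 x z"
  and cross2_scale_right: "cross2 z (r *\<^sub>R x) = r * cross2 z x"
  and cross2_self: "cross2 x x = 0"
  by (simp_all add: cross2_def algebra_simps)

lemmas cross2_simps = cross2_add_left cross2_add_right cross2_diff_left cross2_diff_right
  cross2_scale_left cross2_scale_right cross2_self

lemma cross2_anticommute: "cross2 x y = - cross2 y x"
  by (simp add: cross2_def)

lemma convex_cross2_gt: "convex {x. 0 < r * cross2 d (x - c)}"
proof -
  have "{x. 0 < r * cross2 d (x - c)} =
      {x. inner (- r * snd d, r * fst d) x > inner (- r * snd d, r * fst d) c}"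
    by (auto simp: cross2_def inner_prod_def algebra_simps)
  then show ?thesis by (simp only: convex_halfspace_gt)
qed

lemma open_cross2_gt: "open {x. 0 < r * cross2 d (x - c)}"
proof -
  have "{x. 0 < r * cross2 d (x - c)} =
      {x. inner (- r * snd d, r * fst d) x > inner (- r * snd d, r * fst d) c}"
    by (auto simp: cross2_def inner_prod_def algebra_simps)
  then show ?thesis by (simp only: open_halfspace_gt)
qed

text \<open>Close to a relative interior point of an edge, a simple polygon contains one of the two
  sides of the edge, so a transversal segment through that point meets the interior.\<close>

lemma transversal_meets_interior:
  assumes P: "simple_polygon P" and k: "k < length P"
    and pq: "poly_edge P k = (p, q)"
    and c: "c \<in> open_segment p q" and cab: "c \<in> open_segment a b"
    and tr: "cross2 (q - p) (b - a) \<noteq> 0"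
  shows "closed_segment a b \<inter> obst_interior P \<noteq> {}"
proof -
  define K where "K = (\<Union>j\<in>{..<length P} - {k}.
    closed_segment (fst (poly_edge P j)) (snd (poly_edge P j)))"
  have bd: "poly_boundary P = K \<union> closed_segment p q"
    using k pq unfolding poly_boundary_def K_def by force
  have pP: "p = P ! k" "q = P ! ((k + 1) mod length P)"
    using pq by (auto simp: poly_edge_def)
  have "c \<notin> K"
  proof
    assume "c \<in> K"
    then obtain j where j: "j < length P" "j \<noteq> k"
      "c \<in> closed_segment (fst (poly_edge P j)) (snd (poly_edge P j))"
      unfolding K_def by auto
    have "closed_segment (fst (poly_edge P j)) (snd (poly_edge P j)) \<inter> closed_segment p q
        \<subseteq> {p, q}"
    proof -
      have "closed_segment (fst (poly_edge P j)) (snd (poly_edge P j)) \<inter>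
        closed_segment (fst (poly_edge P k)) (snd (poly_edge P k)) =
          (if k = (j + 1) mod length P then {P ! k}
           else if j = (k + 1) mod length P then {P ! j} else {})"
        using P j(1,2) k unfolding simple_polygon_def by auto
      then show ?thesis using pP pq by (auto split: if_splits)
    qed
    then show False using j(3) c by (auto simp: open_segment_def)
  qed
  moreover have "closed K"
    unfolding K_def by (intro closed_UN) auto
  ultimately obtain e where e: "e > 0" "ball c e \<subseteq> - K"
    using open_contains_ball[of "- K"] by (auto simp: open_Compl)
  let ?f = "\<lambda>x. cross2 (q - p) (x - c)"
  obtain s where s: "c = (1 - s) *\<^sub>R p + s *\<^sub>R q" "0 < s" "s < 1"
    using c by (auto simp: in_segment)
  have seg0: "?f x = 0" if x: "x \<in> closed_segment p q" for x
  proof -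
    obtain r where "x = (1 - r) *\<^sub>R p + r *\<^sub>R q" using x by (auto simp: in_segment)
    then have "x - c = (r - s) *\<^sub>R (q - p)" unfolding s(1) by (simp add: algebra_simps)
    then show ?thesis by (simp only: cross2_scale_right cross2_self)
  qed
  obtain t where t: "c = (1 - t) *\<^sub>R a + t *\<^sub>R b" "0 < t" "t < 1"
    using cab by (auto simp: in_segment)
  let ?W = "obst_interior P \<inter> ball c e"
  have "c \<in> closure (obst_interior P)"
    using poly_boundary_subset_closure_interior[OF P] c bd by (auto simp: open_segment_def)
  then obtain i where i: "i \<in> ?W"
    using e(1) by (metis Int_iff closure_approachable dist_commute mem_ball)
  have "open ?W" by (intro open_Int open_obst_interior open_ball)
  then obtain d where d: "d > 0" "ball i d \<subseteq> ?W"
    using i open_contains_ball by blast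
  have bane: "b \<noteq> a" using tr by (auto simp: cross2_def)
  obtain i' where i': "i' \<in> ?W" "?f i' \<noteq> 0"
  proof (cases "?f i = 0")
    case False
    then show ?thesis using i that by blast
  next
    case True
    let ?r = "d / 2 / norm (b - a)"
    have "i + ?r *\<^sub>R (b - a) \<in> ball i d"
      using d bane by (simp add: dist_norm)
    moreover have "?f (i + ?r *\<^sub>R (b - a)) = ?f i + ?r * cross2 (q - p) (b - a)"
      by (simp add: cross2_simps)
    then have "?f (i + ?r *\<^sub>R (b - a)) \<noteq> 0"
      using True tr d bane by simp
    ultimately show ?thesis using d that by blast
  qed
  define m where "m = min (min t (1 - t)) (e / 2 / norm (b - a))"
  have m: "0 < m" "m \<le> t" "m \<le> 1 - t" "m \<le> e / 2 / norm (b - a)"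
    unfolding m_def using t e bane by auto
  \<comment> \<open>The sign moves \<open>z\<close> to the side of the edge on which
    \<open>i'\<close> lies; the size \<open>m\<close> keeps it on \<open>a b\<close> and in the
    ball.\<close>
  define r where "r = sgn (?f i') * sgn (cross2 (q - p) (b - a)) * m"
  have ra: "\<bar>r\<bar> = m"
    unfolding r_def using m i' tr by (simp add: abs_mult abs_sgn_eq)
  define z where "z = c + r *\<^sub>R (b - a)"
  have "norm (r *\<^sub>R (b - a)) \<le> e / 2 / norm (b - a) * norm (b - a)"
    unfolding norm_scaleR by (intro mult_right_mono) (use ra m in auto)
  then have zb: "z \<in> ball c e"
    using e bane by (simp add: z_def dist_norm)
  have "z = (1 - (t + r)) *\<^sub>R a + (t + r) *\<^sub>R b"
    unfolding z_def t(1) by (simp add: algebra_simps)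
  moreover have "0 \<le> t + r" "t + r \<le> 1" using ra m by linarith+
  ultimately have zab: "z \<in> closed_segment a b" by (auto simp: in_segment)
  have fz: "?f z = r * cross2 (q - p) (b - a)"
    unfolding z_def by (simp add: cross2_simps)
  also have "\<dots> = sgn (?f i') * (\<bar>cross2 (q - p) (b - a)\<bar> * m)"
    unfolding r_def by (simp add: abs_sgn mult_ac)
  finally have sg: "sgn (?f z) = sgn (?f i')"
    using tr m by (simp add: sgn_mult)
  define H where "H = ball c e \<inter> {x. 0 < sgn (?f i') * ?f x}"
  have "connected H"
    unfolding H_def by (intro convex_connected convex_Int convex_ball convex_cross2_gt)
  moreover have "H \<inter> poly_boundary P = {}"
    unfolding H_def bd using e(2) seg0 by force
  moreover have "i' \<in> H"
    unfolding H_def using i' by (auto simp: sgn_if)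
  ultimately have "H \<subseteq> obst_interior P"
    using connected_subset_obst_interior i' by blast
  moreover have "z \<in> H"
    unfolding H_def using zb sg i'(2) by (auto simp: sgn_if split: if_splits)
  ultimately show ?thesis using zab by blast
qed

section \<open>Visibility in triangles\<close>

definition bary :: "pt \<Rightarrow> pt \<Rightarrow> pt \<Rightarrow> real \<Rightarrow> real \<Rightarrow> pt" where
  "bary A M N p q = A + p *\<^sub>R (M - A) + q *\<^sub>R (N - A)"

definition open_triangle :: "pt \<Rightarrow> pt \<Rightarrow> pt \<Rightarrow> pt set" where
  "open_triangle A M N = {bary A M N p q | p q. 0 < p \<and> 0 < q \<and> p + q < 1}"

text \<open>Cramer's rule, with the determinant \<open>?D\<close> cleared in the identity that opens
  the proof.\<close>

lemma ex_bary:
  assumes "cross2 (M - A) (N - A) \<noteq> 0"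
  shows "\<exists>p q. x = bary A M N p q"
proof -
  let ?D = "cross2 (M - A) (N - A)"
  have "?D *\<^sub>R x = ?D *\<^sub>R A + cross2 (x - A) (N - A) *\<^sub>R (M - A) + cross2 (M - A) (x - A) *\<^sub>R (N - A)"
    by (simp add: prod_eq_iff cross2_def algebra_simps)
  then have "x = (1 / ?D) *\<^sub>R (?D *\<^sub>R A + cross2 (x - A) (N - A) *\<^sub>R (M - A) + cross2 (M - A) (x - A) *\<^sub>R (N - A))"
    using assms by (metis (no_types) divide_self_if scaleR_one scaleR_scaleR times_divide_eq_left mult_1)
  then have "x = bary A M N (cross2 (x - A) (N - A) / ?D) (cross2 (M - A) (x - A) / ?D)"
    using assms by (simp add: bary_def scaleR_right_distrib)
  then show ?thesis by blast
qed

lemma cross2_bary: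
  "cross2 (bary A M N p q - A) (bary A M N p' q' - A) = (p * q' - q * p') * cross2 (M - A) (N - A)"
  "cross2 (M - A) (bary A M N p q - A) = q * cross2 (M - A) (N - A)"
  "cross2 (N - A) (bary A M N p q - A) = - p * cross2 (M - A) (N - A)"
  "cross2 (N - M) (bary A M N p q - M) = (1 - p - q) * cross2 (M - A) (N - A)"
  by (simp_all add: bary_def cross2_def algebra_simps)

lemma bary_corners:
  "bary A M N 0 0 = A" "bary A M N 1 0 = M" "bary A M N 0 1 = N"
  by (simp_all add: bary_def)

lemma bary_inj:
  assumes "cross2 (M - A) (N - A) \<noteq> 0" "bary A M N p q = bary A M N p' q'"
  shows "p = p'" "q = q'"
  using assms(1) arg_cong[OF assms(2), of "\<lambda>x. cross2 (N - A) (x - A)"]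
    arg_cong[OF assms(2), of "\<lambda>x. cross2 (M - A) (x - A)"]
  by (auto simp: cross2_bary)

lemma bary_segment:
  "(1 - t) *\<^sub>R bary A M N p q + t *\<^sub>R bary A M N p' q' =
    bary A M N ((1 - t) * p + t * p') ((1 - t) * q + t * q')"
  by (simp add: bary_def algebra_simps)

lemma bary_bary:
  "bary A M (bary A M N p q) r s = bary A M N (r + s * p) (s * q)"
  by (simp add: bary_def algebra_simps)

lemma in_triangle_iff:
  "x \<in> convex hull {A, M, N} \<longleftrightarrow> (\<exists>p q. 0 \<le> p \<and> 0 \<le> q \<and> p + q \<le> 1 \<and> x = bary A M N p q)"
  unfolding convex_hull_3_alt bary_def by blast

text \<open>A point moving along a segment leaves the region where two affine functions are
  nonnegative at the earlier of their zeros, where the other function is still nonnegative.\<close>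

lemma two_affine_exit:
  fixes a0 b0 a1 b1 :: real
  assumes "0 < a0" "0 < b0" "a1 < 0 \<or> b1 < 0"
  obtains t where "0 \<le> t" "t \<le> 1"
    "(1 - t) * a0 + t * a1 = 0 \<and> 0 \<le> (1 - t) * b0 + t * b1 \<or>
     (1 - t) * b0 + t * b1 = 0 \<and> 0 \<le> (1 - t) * a0 + t * a1"
proof -
  have main: "\<exists>t. 0 \<le> t \<and> t \<le> 1 \<and> (1 - t) * c0 + t * c1 = 0 \<and> 0 \<le> (1 - t) * d0 + t * d1"
    if c: "0 < c0" "c1 < 0" "c1 * d0 \<le> c0 * d1" for c0 c1 d0 d1 :: real
  proof (intro exI conjI)
    let ?t = "c0 / (c0 - c1)"
    have t: "1 - ?t = - c1 / (c0 - c1)" using c by (simp add: field_simps)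
    show "0 \<le> ?t" "?t \<le> 1" using c by (auto simp: field_simps)
    show "(1 - ?t) * c0 + ?t * c1 = 0" unfolding t using c by (simp add: field_simps)
    have "(1 - ?t) * d0 + ?t * d1 = (c0 * d1 - c1 * d0) / (c0 - c1)"
      unfolding t by (simp add: diff_divide_distrib)
    then show "0 \<le> (1 - ?t) * d0 + ?t * d1" using c by simp
  qed
  \<comment> \<open>The cross-multiplied inequality compares the zeros and so selects the function
    that vanishes no later than the other.\<close>
  consider "a1 < 0" "a1 * b0 \<le> a0 * b1" | "b1 < 0" "b1 * a0 \<le> b0 * a1"
  proof (cases "a1 * b0 \<le> a0 * b1")
    case True
    show ?thesis
    proof (cases "a1 < 0")
      case False
      then have "b1 < 0" using assms by simp
      then have "a0 * b1 < 0" using assms by (simp add: mult_pos_neg)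
      moreover have "0 \<le> a1 * b0" using False assms by simp
      ultimately show ?thesis using True by linarith
    qed (use True that in blast)
  next
    case False
    show ?thesis
    proof (cases "b1 < 0")
      case b: False
      then have "a1 < 0" using assms by simp
      then have "a1 * b0 < 0" using assms by (simp add: mult_neg_pos)
      moreover have "0 \<le> a0 * b1" using b assms by simp
      ultimately show ?thesis using False by linarith
    qed (use False that in \<open>simp add: mult.commute\<close>)
  qed
  then show ?thesis
  proof cases
    case 1
    then show ?thesis using main[of a0 a1 b0 b1] assms that by blast
  next
    case 2
    then show ?thesis using main[of b0 b1 a0 a1] assms that by blast
  qed
qed

lemma closed_segment_minus_subset_open:
  fixes a b y :: pt
  assumes "y \<in> open_segment a b"
  shows "closed_segment a y - {a} \<subseteq> open_segment a b"
proof
  fix c assume c: "c \<in> closed_segment a y - {a}"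
  obtain s where s: "y = (1 - s) *\<^sub>R a + s *\<^sub>R b" "0 < s" "s < 1" "a \<noteq> b"
    using assms by (auto simp: in_segment)
  obtain r where r: "c = (1 - r) *\<^sub>R a + r *\<^sub>R y" "0 \<le> r" "r \<le> 1" "c \<noteq> a"
    using c by (auto simp: in_segment)
  have "r \<noteq> 0" using r(1,4) by auto
  then have "0 < r * s" "r * s < 1" using r s by (auto simp: mult_le_one less_le mult_eq_1)
  moreover have "c = (1 - r * s) *\<^sub>R a + (r * s) *\<^sub>R b"
    unfolding r(1) s(1) by (simp add: algebra_simps)
  ultimately show "c \<in> open_segment a b" unfolding in_segment using s(4) by blast
qed

section \<open>Obstacle edges and visible segments\<close>

locale obstacle_setting =
  fixes V :: "pt set" and S :: "pt list set"
  assumes valid: "valid_setting V S" and genpos: "general_position V"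
begin

definition obst_edge :: "pt \<Rightarrow> pt \<Rightarrow> bool" where
  "obst_edge p q \<longleftrightarrow> (\<exists>P\<in>S. \<exists>k<length P. poly_edge P k = (p, q))"

lemma finite_V: "finite V"
  using valid by (simp add: valid_setting_def)

lemma simple_polygon_S: "P \<in> S \<Longrightarrow> simple_polygon P"
  using valid by (simp add: valid_setting_def)

lemma cross2_vertices:
  assumes "a \<in> V" "b \<in> V" "c \<in> V" "a \<noteq> b" "a \<noteq> c" "b \<noteq> c"
  shows "cross2 (b - a) (c - a) \<noteq> 0"
  using assms genpos collinear_if_cross2_eq_0 unfolding general_position_def by blast

lemma poly_edge_vertices:
  assumes "P \<in> S" "k < length P" "poly_edge P k = (p, q)"
  shows "p \<in> set P" "q \<in> set P" "p \<in> V" "q \<in> V" "p \<noteq> q"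
proof -
  have P: "length P \<ge> 3" "distinct P" "set P \<subseteq> V"
    using assms(1) valid by (auto simp: valid_setting_def simple_polygon_def)
  have pq: "p = P ! k" "q = P ! ((k + 1) mod length P)"
    using assms(3) by (auto simp: poly_edge_def)
  have l: "(k + 1) mod length P < length P" using P by (intro mod_less_divisor) auto
  show "p \<in> set P" "q \<in> set P" using pq l assms(2) by auto
  then show "p \<in> V" "q \<in> V" using P by auto
  have "k \<noteq> (k + 1) mod length P"
    using P(1) assms(2) by (cases "k + 1 = length P") auto
  then show "p \<noteq> q" unfolding pq using P l assms(2) by (subst nth_eq_iff_index_eq) auto
qed

lemma obst_edge_vertices:
  assumes "obst_edge p q"
  shows "p \<in> V" "q \<in> V" "p \<noteq> q"
  using assms poly_edge_vertices unfolding obst_edge_def by blast+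

lemma vertex_in_closed_segment:
  assumes "a \<in> V" "b \<in> V" "c \<in> V" "c \<in> closed_segment a b"
  shows "c = a \<or> c = b"
proof (rule ccontr)
  assume n: "\<not> (c = a \<or> c = b)"
  obtain t where t: "c = (1 - t) *\<^sub>R a + t *\<^sub>R b" using assms(4) by (auto simp: in_segment)
  have "c - a = t *\<^sub>R (b - a)" unfolding t by (simp add: algebra_simps)
  then have "cross2 (b - a) (c - a) = 0" by (simp only: cross2_scale_right cross2_self)
  moreover have "a \<noteq> b" using n assms(4) by auto
  ultimately show False using n assms cross2_vertices by blast
qed

text \<open>By general position \<open>c\<close> is interior to both segments. If they are
  transversal, the visible segment enters the obstacle; if they are parallel, all four endpoints are
  collinear, so the segments coincide.\<close>

lemma visible_obst_edge_cross:
  assumes ab: "a \<in> V" "b \<in> V" "visible S a b" and e: "obst_edge p q"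
    and c: "c \<in> open_segment a b" "c \<in> closed_segment p q"
  shows "{a, b} = {p, q}"
proof (rule ccontr)
  assume ne: "{a, b} \<noteq> {p, q}"
  note pq = obst_edge_vertices[OF e]
  have anb: "a \<noteq> b" using c by auto
  have cpq: "c \<noteq> p" "c \<noteq> q"
    using c(1) vertex_in_closed_segment[OF ab(1,2) pq(1)] vertex_in_closed_segment[OF ab(1,2) pq(2)]
    by (auto simp: open_segment_def)
  then have co: "c \<in> open_segment p q" using c by (auto simp: open_segment_def)
  obtain s where s: "c = (1 - s) *\<^sub>R a + s *\<^sub>R b" "0 < s" "s < 1" using c(1) by (auto simp: in_segment)
  obtain t where t: "c = (1 - t) *\<^sub>R p + t *\<^sub>R q" "0 < t" "t < 1" using co by (auto simp: in_segment)
  have tr: "cross2 (q - p) (b - a) \<noteq> 0"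
  proof
    assume z: "cross2 (q - p) (b - a) = 0"
    have "a - p = t *\<^sub>R (q - p) - s *\<^sub>R (b - a)"
      using s t by (simp add: algebra_simps)
    then have "cross2 (q - p) (a - p) = 0"
      using z cross2_self[of "q - p"] by (simp only: cross2_add_right cross2_diff_right[of _ "_ *\<^sub>R _"] cross2_scale_right)
    then have a: "a = p \<or> a = q" using cross2_vertices[of p q a] ab pq by blast
    have "b - p = t *\<^sub>R (q - p) + (1 - s) *\<^sub>R (b - a)"
      using s t by (simp add: algebra_simps)
    then have "cross2 (q - p) (b - p) = 0"
      using z cross2_self[of "q - p"] by (simp only: cross2_add_right cross2_diff_right[of _ "_ *\<^sub>R _"] cross2_scale_right)
    then have "b = p \<or> b = q" using cross2_vertices[of p q b] ab pq by blast
    then show False using a ne anb by auto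
  qed
  obtain P k where P: "P \<in> S" "k < length P" "poly_edge P k = (p, q)"
    using e by (auto simp: obst_edge_def)
  have "closed_segment a b \<inter> obst_interior P \<noteq> {}"
    using transversal_meets_interior[OF simple_polygon_S[OF P(1)] P(2,3) co c(1) tr] .
  then show False using ab(3) P(1) by (auto simp: visible_def)
qed

lemma poly_boundary_obst_edge:
  assumes "P \<in> S" "x \<in> poly_boundary P"
  obtains p q where "obst_edge p q" "x \<in> closed_segment p q" "p \<in> set P" "q \<in> set P"
    "closed_segment p q \<subseteq> poly_boundary P"
proof -
  obtain k where k: "k < length P" "x \<in> closed_segment (fst (poly_edge P k)) (snd (poly_edge P k))"
    using assms(2) by (auto simp: poly_boundary_def)
  have "obst_edge (fst (poly_edge P k)) (snd (poly_edge P k))"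
    using k assms unfolding obst_edge_def by auto
  moreover have "closed_segment (fst (poly_edge P k)) (snd (poly_edge P k)) \<subseteq> poly_boundary P"
    using k unfolding poly_boundary_def by auto
  ultimately show ?thesis
    using k that poly_edge_vertices[OF assms(1) k(1), of "fst (poly_edge P k)" "snd (poly_edge P k)"] by auto
qed

text \<open>Rotating the ray from \<open>A\<close> through \<open>M\<close> towards \<open>N\<close> until it first hits a vertex \<open>z\<close> of the
  triangle sweeps an area that no obstacle boundary can enter: a boundary edge meeting it would
  have to leave it through \<open>A M\<close> or \<open>M N\<close>.\<close>

lemma swept_triangle:
  assumes A: "A \<in> V" and N: "N \<in> V"
    and nd: "cross2 (M - A) (N - A) \<noteq> 0"
    and AM: "\<And>x. x \<in> V \<Longrightarrow> x \<in> closed_segment A M \<Longrightarrow> x = A \<or> x = M"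
    and H: "\<And>p q c. obst_edge p q \<Longrightarrow> c \<in> closed_segment p q \<Longrightarrow>
      c \<in> closed_segment A M \<union> closed_segment M N \<Longrightarrow> c \<noteq> A \<Longrightarrow> c \<noteq> N \<Longrightarrow>
      closed_segment p q \<inter> open_triangle A M N = {}"
    and M: "\<And>P. P \<in> S \<Longrightarrow> M \<notin> closure (open_triangle A M N \<inter> obst_interior P)"
  shows "\<exists>z\<in>V \<inter> convex hull {A, M, N} - {A, M}.
    (\<forall>x\<in>V \<inter> convex hull {A, M, N} - {A, M}.
      0 \<le> cross2 (z - A) (x - A) * cross2 (M - A) (N - A)) \<and>
    (\<forall>P\<in>S. convex hull {A, M, z} \<inter> obst_interior P = {})"
proof -
  define D where "D = cross2 (M - A) (N - A)"
  define X where "X = (V \<inter> convex hull {A, M, N}) - {A, M}"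
  \<comment> \<open>In barycentric coordinates this is \<open>p / q\<close>, which decreases as the
    ray turns from \<open>M\<close> towards \<open>N\<close>; maximising it finds the vertex hit
    first.\<close>
  define rat where "rat x = cross2 (x - A) (N - A) / cross2 (M - A) (x - A)" for x
  have ratb: "rat (bary A M N p q) = p / q" for p q
    using nd cross2_anticommute[of _ "N - A"] by (simp add: rat_def cross2_bary)
  have posX: "0 < q" if "bary A M N p q \<in> X" "0 \<le> p" "0 \<le> q" "p + q \<le> 1" for p q
  proof (rule ccontr)
    assume "\<not> 0 < q"
    then have "q = 0" using that by simp
    then have "bary A M N p q = (1 - p) *\<^sub>R A + p *\<^sub>R M" by (simp add: bary_def algebra_simps)
    then have "bary A M N p q \<in> closed_segment A M"
      using that \<open>q = 0\<close> by (auto simp: in_segment)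
    then show False using AM[of "bary A M N p q"] that(1) by (simp add: X_def)
  qed
  have "N \<noteq> A" "N \<noteq> M" using nd by (auto simp: cross2_def)
  then have "N \<in> X" using N by (auto simp: X_def hull_inc)
  moreover have "finite X" using finite_V by (simp add: X_def)
  ultimately have "Max (rat ` X) \<in> rat ` X" by (intro Max_in) auto
  then obtain z where zX: "z \<in> X" and "rat z = Max (rat ` X)" by auto
  then have zmax: "rat x \<le> rat z" if "x \<in> X" for x using that \<open>finite X\<close> by simp
  obtain pz qz where z: "0 \<le> pz" "0 \<le> qz" "pz + qz \<le> 1" "z = bary A M N pz qz"
    using zX by (auto simp: X_def in_triangle_iff)
  have qz: "0 < qz" using posX z zX by blast
  have ratle: "p * qz \<le> q * pz" if "bary A M N p q \<in> X" "0 \<le> p" "0 \<le> q" "p + q \<le> 1" for p q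
    using zmax[OF that(1)] posX[OF that] qz unfolding z(4) ratb by (simp add: field_simps)
  \<comment> \<open>The swept area is cut from the open triangle by the ray through
    \<open>z\<close>. It reaches up to the side \<open>M N\<close>, beyond the triangle on
    \<open>A\<close>, \<open>M\<close> and \<open>z\<close>.\<close>
  define W where "W = {x. 0 < (- 1 / D) * cross2 (N - A) (x - A)} \<inter>
     {x. 0 < (1 / D) * cross2 (M - A) (x - A)} \<inter> {x. 0 < (1 / D) * cross2 (N - M) (x - M)} \<inter>
     {x. 0 < (- 1 / D) * cross2 (z - A) (x - A)}"
  have W: "bary A M N p q \<in> W \<longleftrightarrow> 0 < p \<and> 0 < q \<and> p + q < 1 \<and> q * pz < p * qz" for p q
    using nd unfolding W_def z(4) by (auto simp: cross2_bary D_def[symmetric] mult.commute)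
  have "convex W" unfolding W_def by (intro convex_Int convex_cross2_gt)
  have WO: "W \<subseteq> open_triangle A M N"
  proof
    fix x assume "x \<in> W"
    moreover obtain p q where "x = bary A M N p q" using ex_bary[OF nd] by blast
    ultimately show "x \<in> open_triangle A M N" using W by (auto simp: open_triangle_def)
  qed
  \<comment> \<open>Such an endpoint inside the triangle would beat \<open>z\<close> in
    \<open>rat\<close>. Outside it, the part of the edge from \<open>c\<close> to \<open>i\<close>
    stays on the swept side of the ray, so it must leave through \<open>A M\<close> or
    \<open>M N\<close>, which \<open>H\<close> forbids.\<close>
  have key: False
    if e: "obst_edge p q" "c \<in> W" "c \<in> closed_segment p q" and i: "i = p \<or> i = q"
      and pos: "i = bary A M N p1 q1" "q1 * pz < p1 * qz" for p q c i p1 q1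
  proof -
    have iV: "i \<in> V" and ipq: "i \<in> closed_segment p q" using i obst_edge_vertices[OF e(1)] by auto
    have cT: "c \<in> open_triangle A M N" using e(2) WO by blast
    obtain p0 q0 where c: "c = bary A M N p0 q0" using ex_bary[OF nd] by blast
    then have c0: "0 < p0" "0 < q0" "p0 + q0 < 1" "q0 * pz < p0 * qz" using e(2) W by auto
    show False
    proof (cases "0 \<le> q1 \<and> 0 \<le> 1 - p1 - q1")
      case True
      then have "0 \<le> q1 * pz" using z by simp
      then have p1: "0 < p1" using pos(2) qz by (smt (verit) mult_nonpos_nonneg)
      have "i \<noteq> A" using bary_inj[OF nd, of p1 q1 0 0] p1 pos(1) by (auto simp: bary_corners)
      moreover have "i \<noteq> M" using H[OF e(1) ipq] e(3) cT calculation \<open>N \<noteq> M\<close> by auto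
      moreover have "i \<in> convex hull {A, M, N}"
        unfolding in_triangle_iff using True p1 pos(1) by (intro exI[of _ p1] exI[of _ q1]) auto
      ultimately have "i \<in> X" using iV by (simp add: X_def)
      then show False using ratle[of p1 q1] pos True p1 by auto
    next
      case False
      then have "0 < q0" "0 < 1 - p0 - q0" "q1 < 0 \<or> 1 - p1 - q1 < 0" using c0 by auto
      then obtain t where t: "0 \<le> t" "t \<le> 1"
        "(1 - t) * q0 + t * q1 = 0 \<and> 0 \<le> (1 - t) * (1 - p0 - q0) + t * (1 - p1 - q1) \<or>
         (1 - t) * (1 - p0 - q0) + t * (1 - p1 - q1) = 0 \<and> 0 \<le> (1 - t) * q0 + t * q1"
        by (rule two_affine_exit)
      define p2 where "p2 = (1 - t) * p0 + t * p1"
      define q2 where "q2 = (1 - t) * q0 + t * q1"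
      have t': "q2 = 0 \<and> p2 + q2 \<le> 1 \<or> p2 + q2 = 1 \<and> 0 \<le> q2"
        using t(3) unfolding p2_def q2_def by (auto simp: algebra_simps)
      have "0 < (1 - t) * (p0 * qz - q0 * pz) + t * (p1 * qz - q1 * pz)"
        using t(1,2) c0(4) pos(2)
        by (cases "t = 0") (auto intro!: add_nonneg_pos mult_nonneg_nonneg mult_pos_pos)
      then have l2: "q2 * pz < p2 * qz" unfolding p2_def q2_def by (simp add: algebra_simps)
      have "0 \<le> q2 * pz" using t' z by auto
      then have p2: "0 < p2" using l2 qz by (smt (verit) mult_nonpos_nonneg)
      define y where "y = bary A M N p2 q2"
      have yci: "y = (1 - t) *\<^sub>R c + t *\<^sub>R i"
        unfolding y_def c pos(1) bary_segment p2_def q2_def ..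
      then have "y \<in> closed_segment c i" using t by (auto simp: in_segment)
      then have ypq: "y \<in> closed_segment p q"
        using e(3) ipq subset_closed_segment by blast
      have yA: "y \<noteq> A" using bary_inj[OF nd, of p2 q2 0 0] p2 by (auto simp: bary_corners y_def)
      have yN: "y \<noteq> N" using bary_inj[OF nd, of p2 q2 0 1] p2 by (auto simp: bary_corners y_def)
      have "y \<in> closed_segment A M \<union> closed_segment M N"
      proof (cases "q2 = 0")
        case True
        then have "y = (1 - p2) *\<^sub>R A + p2 *\<^sub>R M" by (simp add: y_def bary_def algebra_simps)
        moreover have "0 \<le> p2" "p2 \<le> 1" using p2 t' True by auto
        ultimately have "y \<in> closed_segment A M" unfolding in_segment by blast
        then show ?thesis by blast
      next
        case q2: False
        then have p2q: "p2 = 1 - q2" using t' by auto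
        have "y = (1 - q2) *\<^sub>R M + q2 *\<^sub>R N"
          unfolding y_def bary_def p2q by (simp add: algebra_simps)
        moreover have "0 \<le> q2" "q2 \<le> 1" using p2 t' q2 by auto
        ultimately have "y \<in> closed_segment M N" unfolding in_segment by blast
        then show ?thesis by blast
      qed
      then show False using H[OF e(1) ypq _ yA yN] e(3) cT by blast
    qed
  qed
  have Wfree: "c \<notin> closed_segment p q" if e: "obst_edge p q" "c \<in> W" for p q c
  proof
    assume cpq: "c \<in> closed_segment p q"
    obtain t where t: "c = (1 - t) *\<^sub>R p + t *\<^sub>R q" "0 \<le> t" "t \<le> 1"
      using cpq by (auto simp: in_segment)
    obtain p0 q0 where p: "p = bary A M N p0 q0" using ex_bary[OF nd] by blast
    obtain p1 q1 where q: "q = bary A M N p1 q1" using ex_bary[OF nd] by blast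
    have "c = bary A M N ((1 - t) * p0 + t * p1) ((1 - t) * q0 + t * q1)"
      unfolding t(1) p q bary_segment ..
    then have "((1 - t) * q0 + t * q1) * pz < ((1 - t) * p0 + t * p1) * qz"
      using e(2) W by blast
    then have "0 < (1 - t) * (p0 * qz - q0 * pz) + t * (p1 * qz - q1 * pz)"
      by (simp add: algebra_simps)
    then have "q0 * pz < p0 * qz \<or> q1 * pz < p1 * qz"
      using t(2,3) by (smt (verit) mult_nonneg_nonneg mult_nonneg_nonpos)
    then show False using key[OF e cpq] p q by blast
  qed
  \<comment> \<open>The centroid of \<open>A\<close>, \<open>M\<close> and \<open>z\<close>;
    segments from it show that this closed triangle lies in the closure of \<open>W\<close>.\<close>
  define g where "g = bary A M N ((1 + pz) / 3) (qz / 3)"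
  have gW: "g \<in> W" unfolding g_def W using z qz by (auto simp: field_simps)
  have clW: "x \<in> closure W" if x: "x \<in> convex hull {A, M, z}" for x
  proof -
    obtain r s where rs: "0 \<le> r" "0 \<le> s" "r + s \<le> 1" "x = bary A M z r s"
      using x by (auto simp: in_triangle_iff)
    have xb: "x = bary A M N (r + s * pz) (s * qz)" by (simp add: rs z(4) bary_bary)
    have "s * (pz + qz) \<le> s" using rs z by (simp add: mult_left_le)
    then have x1: "0 \<le> r + s * pz" "0 \<le> s * qz" "r + s * pz + s * qz \<le> 1" "s * qz * pz \<le> (r + s * pz) * qz"
      using rs z qz by (auto simp: algebra_simps)
    have "open_segment g x \<subseteq> W"
    proof
      fix y assume "y \<in> open_segment g x"
      then obtain t where t: "0 < t" "t < 1" "y = (1 - t) *\<^sub>R g + t *\<^sub>R x"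
        by (auto simp: in_segment)
      let ?p = "(1 - t) * ((1 + pz) / 3) + t * (r + s * pz)" and ?q = "(1 - t) * (qz / 3) + t * (s * qz)"
      have yb: "y = bary A M N ?p ?q" unfolding t(3) g_def xb bary_segment ..
      have "0 < ?p" using t x1 z by (intro add_pos_nonneg) auto
      moreover have "0 < ?q" using t x1 qz rs by (intro add_pos_nonneg) auto
      moreover have "?p + ?q < 1"
      proof -
        have "?p + ?q = (1 - t) * ((1 + pz + qz) / 3) + t * (r + s * pz + s * qz)" by (simp add: algebra_simps add_divide_distrib)
        also have "\<dots> \<le> (1 - t) * (2 / 3) + t * 1"
          using t x1 z by (intro add_mono mult_left_mono) auto
        also have "\<dots> < 1" using t by (simp add: field_simps)
        finally show ?thesis .
      qed
      moreover have "?q * pz < ?p * qz"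
      proof -
        have "?p * qz - ?q * pz = (1 - t) * (qz / 3) + t * (r * qz)"
          by (simp add: field_simps)
        also have "\<dots> > 0" using t qz rs by (intro add_pos_nonneg) auto
        finally show ?thesis by simp
      qed
      ultimately show "y \<in> W" unfolding yb W by blast
    qed
    then have "closure (open_segment g x) \<subseteq> closure W" by (rule closure_mono)
    then show ?thesis
      using gW closure_subset[of W] by (cases "g = x") auto
  qed
  have WI: "W \<inter> obst_interior P = {}" if P: "P \<in> S" for P
  proof (rule ccontr)
    assume "W \<inter> obst_interior P \<noteq> {}"
    then obtain x where x: "x \<in> W" "x \<in> obst_interior P" by blast
    \<comment> \<open>Free of boundary and connected, \<open>W\<close> lies inside an obstacle as
      soon as it meets it; \<open>M\<close> would then be a limit of obstacle points in the
      triangle.\<close>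
    have "W \<inter> poly_boundary P = {}"
      using Wfree poly_boundary_obst_edge[OF P] by blast
    then have "W \<subseteq> obst_interior P"
      using connected_subset_obst_interior convex_connected[OF \<open>convex W\<close>] x by blast
    then have "W \<subseteq> open_triangle A M N \<inter> obst_interior P" using WO by blast
    then have "closure W \<subseteq> closure (open_triangle A M N \<inter> obst_interior P)" by (rule closure_mono)
    moreover have "M \<in> closure W" by (intro clW) (simp add: hull_inc)
    ultimately show False using M[OF P] by blast
  qed
  have "0 \<le> cross2 (z - A) (x - A) * cross2 (M - A) (N - A)" if x: "x \<in> X" for x
  proof -
    obtain p q where pq: "0 \<le> p" "0 \<le> q" "p + q \<le> 1" "x = bary A M N p q"
      using x by (auto simp: X_def in_triangle_iff)
    then have "p * qz \<le> q * pz" using x by (intro ratle) auto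
    then have "0 \<le> (pz * q - qz * p) * (D * D)" by (simp add: mult.commute)
    then show ?thesis unfolding z(4) pq(4) cross2_bary D_def by (simp add: mult.assoc)
  qed
  moreover have "convex hull {A, M, z} \<inter> obst_interior P = {}" if "P \<in> S" for P
    using clW WI[OF that] open_Int_closure_eq_empty[OF open_obst_interior, of P W] by blast
  ultimately show ?thesis using zX unfolding X_def by blast
qed

text \<open>Two segments with a common endpoint that also meet in an interior point of both lie on
  one line, so general position makes them equal.\<close>

lemma crossing_distinct:
  assumes V: "u \<in> V" "w \<in> V" "v \<in> V" "x \<in> V" and ne: "{u, w} \<noteq> {v, x}"
    and y: "y \<in> open_segment u w" "y \<in> open_segment v x"
  shows "u \<noteq> v" "u \<noteq> x" "w \<noteq> v" "w \<noteq> x"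
proof -
  have main: "b = c" if abc: "a \<in> V" "b \<in> V" "c \<in> V" and y: "y \<in> open_segment a b" "y \<in> open_segment a c" for a b c
  proof (rule ccontr)
    assume bc: "b \<noteq> c"
    obtain s where s: "y = (1 - s) *\<^sub>R a + s *\<^sub>R b" "0 < s" "s < 1" "a \<noteq> b"
      using y by (auto simp: in_segment)
    obtain t where t: "y = (1 - t) *\<^sub>R a + t *\<^sub>R c" "0 < t" "t < 1" "a \<noteq> c"
      using y by (auto simp: in_segment)
    have "s *\<^sub>R (b - a) = t *\<^sub>R (c - a)" using s(1) t(1) by (simp add: algebra_simps)
    then have "s * cross2 (b - a) (c - a) = 0"
      by (metis cross2_scale_left cross2_self mult_zero_right)
    then show False using cross2_vertices[of a b c] abc bc s t by simp
  qed
  have y': "y \<in> open_segment w u" "y \<in> open_segment x v"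
    using y by (simp_all add: open_segment_commute)
  show "u \<noteq> v" using main[OF V(1,2,4) y(1)] y(2) ne by blast
  show "u \<noteq> x" using main[OF V(1,2,3) y(1)] y'(2) ne by blast
  show "w \<noteq> v" using main[OF V(2,1,4) y'(1)] y(2) ne by blast
  show "w \<noteq> x" using main[OF V(2,1,3) y'(1)] y'(2) ne by blast
qed

lemma not_in_closure_interior:
  assumes "P \<in> S" "x \<notin> obst_interior P" "x \<notin> poly_boundary P"
  shows "x \<notin> closure (obst_interior P)"
  using assms closure_inside_subset[OF compact_imp_closed[OF compact_poly_boundary[of P]]]
  unfolding obst_interior_def by blast

lemma open_triangle_off_sides:
  assumes "cross2 (M - A) (N - A) \<noteq> 0" "x \<in> open_triangle A M N"
  shows "cross2 (M - A) (x - A) \<noteq> 0" "cross2 (N - A) (x - A) \<noteq> 0" "cross2 (N - M) (x - M) \<noteq> 0"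
  using assms by (auto simp: open_triangle_def cross2_bary)

lemma cross2_segment:
  assumes "x \<in> closed_segment a b" "c \<in> closed_segment a b" "d \<in> closed_segment a b"
  shows "cross2 (c - d) (x - d) = 0"
proof -
  obtain r s t where e: "x = (1 - r) *\<^sub>R a + r *\<^sub>R b" "c = (1 - s) *\<^sub>R a + s *\<^sub>R b" "d = (1 - t) *\<^sub>R a + t *\<^sub>R b"
    using assms by (auto simp: in_segment)
  have "x - d = (r - t) *\<^sub>R (b - a)" "c - d = (s - t) *\<^sub>R (b - a)"
    unfolding e by (simp_all add: algebra_simps)
  then show ?thesis by (simp only: cross2_scale_left cross2_scale_right cross2_self mult_zero_right)
qed

text \<open>The sweep is about \<open>u\<close>, starting at \<open>y\<close>. Both
  \<open>u y\<close> and \<open>y x\<close> are parts of visible segments, so an obstacle edge can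
  touch them away from \<open>u\<close> and \<open>x\<close> only by running along one of the two
  segments, hence outside the open triangle.\<close>

lemma crossing_subcone_vertex:
  assumes V: "u \<in> V" "w \<in> V" "v \<in> V" "x \<in> V" and ne: "{u, w} \<noteq> {v, x}"
    and vis: "visible S u w" "visible S v x"
    and y: "y \<in> open_segment u w" "y \<in> open_segment v x"
  obtains z where "z \<in> V" "z \<in> convex hull {u, y, x}" "z \<noteq> u" "z \<noteq> w"
    "visible S u z" "same_subcone S u w z"
proof -
  note dist = crossing_distinct[OF V ne y]
  obtain s where s: "y = (1 - s) *\<^sub>R u + s *\<^sub>R w" "0 < s" "s < 1" and uw: "u \<noteq> w"
    using y by (auto simp: in_segment)
  have yu: "y - u = s *\<^sub>R (w - u)" unfolding s(1) by (simp add: algebra_simps)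
  have nd: "cross2 (y - u) (x - u) \<noteq> 0"
    unfolding yu cross2_scale_left using cross2_vertices[of u w x] V dist s uw by auto
  have seg1: "closed_segment u y - {u} \<subseteq> open_segment u w"
    using closed_segment_minus_subset_open[OF y(1)] .
  have seg2: "closed_segment y x - {x} \<subseteq> open_segment v x"
    using closed_segment_minus_subset_open[of y x v] y(2)
    by (simp add: closed_segment_commute open_segment_commute)
  have AM: "a = u \<or> a = y" if "a \<in> V" "a \<in> closed_segment u y" for a
  proof (rule ccontr)
    assume "\<not> (a = u \<or> a = y)"
    then have "a \<in> open_segment u w" using that seg1 by blast
    then show False
      using vertex_in_closed_segment[OF V(1,2) that(1)] by (auto simp: open_segment_def)
  qed
  have H: "closed_segment p q \<inter> open_triangle u y x = {}"
    if e: "obst_edge p q" "c \<in> closed_segment p q"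
      and c: "c \<in> closed_segment u y \<union> closed_segment y x" "c \<noteq> u" "c \<noteq> x" for p q c
  proof -
    have "c \<in> open_segment u w \<or> c \<in> open_segment v x" using c seg1 seg2 by blast
    then have "{u, w} = {p, q} \<or> {v, x} = {p, q}"
      using visible_obst_edge_cross[OF V(1,2) vis(1) e(1) _ e(2)]
        visible_obst_edge_cross[OF V(3,4) vis(2) e(1) _ e(2)] by blast
    then have "closed_segment p q = closed_segment u w \<or> closed_segment p q = closed_segment v x"
      by (auto simp: doubleton_eq_iff closed_segment_commute)
    moreover have "b \<notin> open_triangle u y x" if "b \<in> closed_segment u w" for b
      using open_triangle_off_sides(1)[OF nd, of b] cross2_segment[OF that, of y u] y by (auto simp: open_segment_def)
    moreover have "b \<notin> open_triangle u y x" if "b \<in> closed_segment v x" for b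
      using open_triangle_off_sides(3)[OF nd, of b] cross2_segment[OF that, of x y] y by (auto simp: open_segment_def)
    ultimately show ?thesis by blast
  qed
  have M: "y \<notin> closure (open_triangle u y x \<inter> obst_interior P)" if P: "P \<in> S" for P
  proof -
    have "y \<notin> obst_interior P"
      using vis(1) y(1) P by (auto simp: visible_def open_segment_def)
    moreover have "y \<notin> poly_boundary P"
    proof
      assume "y \<in> poly_boundary P"
      then obtain p q where e: "obst_edge p q" "y \<in> closed_segment p q"
        using poly_boundary_obst_edge[OF P] by metis
      have "{u, w} = {p, q}" "{v, x} = {p, q}"
        using visible_obst_edge_cross[OF V(1,2) vis(1) e(1) y(1) e(2)]
          visible_obst_edge_cross[OF V(3,4) vis(2) e(1) y(2) e(2)] by auto
      then show False using ne by simp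
    qed
    ultimately have "y \<notin> closure (obst_interior P)" using not_in_closure_interior[OF P] by blast
    then show ?thesis using closure_mono[of "open_triangle u y x \<inter> obst_interior P" "obst_interior P"] by blast
  qed
  obtain z where z: "z \<in> V" "z \<in> convex hull {u, y, x}" "z \<noteq> u" "z \<noteq> y"
    and zf: "\<And>P. P \<in> S \<Longrightarrow> convex hull {u, y, z} \<inter> obst_interior P = {}"
  proof -
    have "\<exists>z\<in>V \<inter> convex hull {u, y, x} - {u, y}.
      (\<forall>a\<in>V \<inter> convex hull {u, y, x} - {u, y}. 0 \<le> cross2 (z - u) (a - u) * cross2 (y - u) (x - u)) \<and>
      (\<forall>P\<in>S. convex hull {u, y, z} \<inter> obst_interior P = {})"
      by (rule swept_triangle[OF V(1,4) nd]) (fact AM H M)+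
    then show thesis using that by blast
  qed
  have zw: "z \<noteq> w"
  proof
    assume "z = w"
    obtain p q where pq: "0 \<le> p" "0 \<le> q" "p + q \<le> 1" "z = bary u y x p q"
      using z by (auto simp: in_triangle_iff)
    have "w = bary u y x (1 / s) 0"
      using s(2) unfolding bary_def yu by simp
    then have "p = 1 / s" using bary_inj(1)[OF nd] pq \<open>z = w\<close> by metis
    moreover have "1 < 1 / s" using s(2,3) by simp
    ultimately show False using pq by linarith
  qed
  have nz: "cross2 (y - u) (z - u) \<noteq> 0"
    unfolding yu cross2_scale_left using cross2_vertices[of u w z] V z zw s uw by auto
  define D where "D = cross2 (y - u) (z - u)"
  have "visible S u z"
  proof -
    have "closed_segment u z \<subseteq> convex hull {u, y, z}"
      by (intro closed_segment_subset_convex_hull) (auto simp: hull_inc)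
    then show ?thesis using zf unfolding visible_def by blast
  qed
  moreover have "same_subcone S u w z"
    unfolding same_subcone_def
  proof safe
    fix P assume P: "P \<in> S" and cl: "u \<in> closure (sector u w z \<inter> obst_interior P)"
    \<comment> \<open>The side of the line \<open>y z\<close> that contains \<open>u\<close>: within
      it, the sector of \<open>w\<close> and \<open>z\<close> is contained in the swept triangle, so
      no obstacle reaches \<open>u\<close> there.\<close>
    let ?O = "{a. 0 < (1 / D) * cross2 (z - y) (a - y)}"
    have "cross2 (z - y) (u - y) = D" by (simp add: D_def cross2_def algebra_simps)
    then have "u \<in> ?O" using nz by (simp add: D_def)
    then have "?O \<inter> (sector u w z \<inter> obst_interior P) \<noteq> {}"
      using cl open_cross2_gt[of "1 / D" "z - y" y] by (metis (no_types, lifting) IntI empty_iff open_Int_closure_eq_empty)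
    then obtain a where a: "a \<in> ?O" "a \<in> sector u w z" "a \<in> obst_interior P" by blast
    obtain r t where rt: "0 \<le> r" "0 \<le> t" "a = u + r *\<^sub>R (w - u) + t *\<^sub>R (z - u)"
      using a(2) by (auto simp: sector_def)
    have ab: "a = bary u y z (r / s) t" using rt(3) s(2) unfolding bary_def yu by simp
    have "0 < 1 - r / s - t" using a(1) nz unfolding ab by (simp add: cross2_bary D_def)
    then have "a \<in> convex hull {u, y, z}"
      unfolding in_triangle_iff using rt s ab by (intro exI[of _ "r / s"] exI[of _ t]) auto
    then show False using zf[OF P] a(3) by blast
  qed
  ultimately show ?thesis using that z zw by blast
qed

text \<open>The sweep is about \<open>v\<close>, from \<open>u\<close> towards \<open>w\<close>.
  Visibility controls the sides except at \<open>u\<close>, where an obstacle with corner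
  \<open>u\<close> could start between them; this is what the subcone condition excludes. The
  extremality of \<open>z\<close> later makes the chain convex.\<close>

lemma subcone_triangle_step:
  assumes V: "u \<in> V" "v \<in> V" "w \<in> V" "u \<noteq> v" "u \<noteq> w" "v \<noteq> w"
    and vis: "visible S u v" "visible S u w" and sub: "same_subcone S u v w"
  obtains z where "z \<in> V" "z \<in> convex hull {u, v, w}" "z \<noteq> u" "z \<noteq> v"
    "visible S u z" "visible S v z"
    "\<And>x. \<lbrakk>x \<in> V; x \<in> convex hull {u, v, w}; x \<noteq> u; x \<noteq> v\<rbrakk> \<Longrightarrow>
      0 \<le> cross2 (z - v) (x - v) * cross2 (u - v) (w - v)"
proof -
  have nd: "cross2 (u - v) (w - v) \<noteq> 0" using cross2_vertices[of v u w] V by auto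
  have AM: "a = v \<or> a = u" if "a \<in> V" "a \<in> closed_segment v u" for a
    using vertex_in_closed_segment[OF V(2,1)] that by blast
  \<comment> \<open>The open sector at \<open>u\<close>: open, so that closure arguments apply, and
    between the open triangle and \<open>sector\<close>.\<close>
  define W where "W = {a. 0 < (1 / cross2 (v - u) (w - u)) * cross2 (v - u) (a - u)} \<inter>
      {a. 0 < (- 1 / cross2 (v - u) (w - u)) * cross2 (w - u) (a - u)}"
  have T_sector: "open_triangle v u w \<subseteq> W" and O_sector: "W \<subseteq> sector u v w"
  proof -
    have nd': "cross2 (v - u) (w - u) \<noteq> 0" using cross2_vertices[of u v w] V by auto
    have O: "bary u v w p q \<in> W \<longleftrightarrow> 0 < p \<and> 0 < q" for p q
      using nd' by (auto simp: W_def cross2_bary)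
    have "bary v u w p q = bary u v w (1 - p - q) q" for p q
      by (simp add: bary_def algebra_simps)
    then show "open_triangle v u w \<subseteq> W" using O unfolding open_triangle_def by auto
    show "W \<subseteq> sector u v w"
    proof
      fix a assume "a \<in> W"
      moreover obtain p q where "a = bary u v w p q" using ex_bary[OF nd'] by blast
      ultimately have "0 < p" "0 < q" "a = u + p *\<^sub>R (v - u) + q *\<^sub>R (w - u)"
        using O by (auto simp: bary_def)
      then show "a \<in> sector u v w" unfolding sector_def using less_imp_le by blast
    qed
  qed
  have openO: "open W" unfolding W_def by (intro open_Int open_cross2_gt)
  have H: "closed_segment p q \<inter> open_triangle v u w = {}"
    if e: "obst_edge p q" "c \<in> closed_segment p q"
      and c: "c \<in> closed_segment v u \<union> closed_segment u w" "c \<noteq> v" "c \<noteq> w" for p q c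
  proof (cases "c = u")
    case False
    then have "c \<in> open_segment u v \<or> c \<in> open_segment u w"
      using c by (auto simp: open_segment_def closed_segment_commute)
    then have "{u, v} = {p, q} \<or> {u, w} = {p, q}"
      using visible_obst_edge_cross[OF V(1,2) vis(1) e(1) _ e(2)]
        visible_obst_edge_cross[OF V(1,3) vis(2) e(1) _ e(2)] by blast
    then have "closed_segment p q = closed_segment u v \<or> closed_segment p q = closed_segment u w"
      by (auto simp: doubleton_eq_iff closed_segment_commute)
    moreover have "b \<notin> open_triangle v u w" if "b \<in> closed_segment u v" for b
      using open_triangle_off_sides(1)[OF nd, of b] cross2_segment[OF that, of u v] by auto
    moreover have "b \<notin> open_triangle v u w" if "b \<in> closed_segment u w" for b
      using open_triangle_off_sides(3)[OF nd, of b] cross2_segment[OF that, of w u] by auto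
    ultimately show ?thesis by blast
  next
    case True
    obtain P k where P: "P \<in> S" "k < length P" "poly_edge P k = (p, q)"
      using e(1) by (auto simp: obst_edge_def)
    have upq: "u = p \<or> u = q"
      using vertex_in_closed_segment[OF obst_edge_vertices(1,2)[OF e(1)] V(1)] e(2) True by blast
    then have uP: "u \<in> set P" using poly_edge_vertices(1,2)[OF P] by blast
    have bd: "closed_segment p q \<subseteq> closure (obst_interior P)"
    proof -
      have "closed_segment p q \<subseteq> poly_boundary P"
        using P(2,3) unfolding poly_boundary_def by force
      then show ?thesis using poly_boundary_subset_closure_interior[OF simple_polygon_S[OF P(1)]] by blast
    qed
    show ?thesis
    proof (rule ccontr)
      assume "closed_segment p q \<inter> open_triangle v u w \<noteq> {}"
      then obtain i where i: "i \<in> closed_segment p q" "i \<in> open_triangle v u w" by blast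
      \<comment> \<open>An edge from \<open>u\<close> into the triangle has points of
        \<open>W\<close> arbitrarily near \<open>u\<close>, and these are limits of obstacle
        interior points, which therefore also enter \<open>W\<close> near \<open>u\<close>.\<close>
      have "u \<in> closure (sector u v w \<inter> obst_interior P)"
        unfolding closure_iff_nhds_not_empty
      proof (intro allI impI)
        fix A U assume U: "U \<subseteq> A" "open U" "u \<in> U"
        have ui: "u \<noteq> i" using i(2) T_sector by (auto simp: W_def cross2_def)
        have "u \<in> closure (open_segment u i)" using ui by simp
        then obtain j where j: "j \<in> open_segment u i" "j \<in> U"
          using U by (metis disjoint_iff open_Int_closure_eq_empty)
        have "j \<in> closed_segment p q"
          using j(1) i(1) upq subset_closed_segment[of u i p q] by (auto simp: open_segment_def)
        then have jc: "j \<in> closure (obst_interior P)" using bd by blast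
        obtain t where t: "j = (1 - t) *\<^sub>R u + t *\<^sub>R i" "0 < t"
          using j(1) by (auto simp: in_segment)
        have ju: "j - u = t *\<^sub>R (i - u)" unfolding t(1) by (simp add: algebra_simps)
        have sc: "r * cross2 d (j - u) = t * (r * cross2 d (i - u))" for r d
          unfolding ju by (simp add: cross2_scale_right)
        have "i \<in> W" using T_sector i(2) by blast
        then have "j \<in> W"
          using t(2) unfolding W_def Int_iff mem_Collect_eq sc by (metis mult_pos_pos)
        then have "(W \<inter> U) \<inter> obst_interior P \<noteq> {}"
          using open_Int_closure_eq_empty[OF open_Int[OF openO U(2)], of "obst_interior P"] jc j(2) by blast
        then show "sector u v w \<inter> obst_interior P \<inter> A \<noteq> {}"
          using O_sector U(1) by blast
      qed
      then show False using sub P(1) uP by (auto simp: same_subcone_def)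
    qed
  qed
  have M: "u \<notin> closure (open_triangle v u w \<inter> obst_interior P)" if P: "P \<in> S" for P
  proof (cases "u \<in> set P")
    case True
    then have "u \<notin> closure (sector u v w \<inter> obst_interior P)"
      using sub P by (auto simp: same_subcone_def)
    moreover have "open_triangle v u w \<inter> obst_interior P \<subseteq> sector u v w \<inter> obst_interior P"
      using T_sector O_sector by blast
    ultimately show ?thesis using closure_mono by blast
  next
    case False
    have "u \<notin> obst_interior P" using vis(1) P by (auto simp: visible_def)
    moreover have "u \<notin> poly_boundary P"
    proof
      assume "u \<in> poly_boundary P"
      then obtain p q where e: "obst_edge p q" "u \<in> closed_segment p q" "p \<in> set P" "q \<in> set P"
        using poly_boundary_obst_edge[OF P] by metis
      then show False
        using vertex_in_closed_segment[OF obst_edge_vertices(1,2)[OF e(1)] V(1)] False by blast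
    qed
    ultimately have "u \<notin> closure (obst_interior P)" using not_in_closure_interior[OF P] by blast
    then show ?thesis
      using closure_mono[of "open_triangle v u w \<inter> obst_interior P" "obst_interior P"] by blast
  qed
  obtain z where z: "z \<in> V" "z \<in> convex hull {v, u, w}" "z \<noteq> v" "z \<noteq> u"
    and zx: "\<And>x. \<lbrakk>x \<in> V; x \<in> convex hull {v, u, w}; x \<noteq> v; x \<noteq> u\<rbrakk> \<Longrightarrow>
      0 \<le> cross2 (z - v) (x - v) * cross2 (u - v) (w - v)"
    and zf: "\<And>P. P \<in> S \<Longrightarrow> convex hull {v, u, z} \<inter> obst_interior P = {}"
  proof -
    have "\<exists>z\<in>V \<inter> convex hull {v, u, w} - {v, u}.
      (\<forall>x\<in>V \<inter> convex hull {v, u, w} - {v, u}. 0 \<le> cross2 (z - v) (x - v) * cross2 (u - v) (w - v)) \<and>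
      (\<forall>P\<in>S. convex hull {v, u, z} \<inter> obst_interior P = {})"
      by (rule swept_triangle[OF V(2,3) nd]) (fact AM H M)+
    then show thesis using that by blast
  qed
  have "closed_segment u z \<subseteq> convex hull {v, u, z}" "closed_segment v z \<subseteq> convex hull {v, u, z}"
    by (intro closed_segment_subset_convex_hull; auto simp: hull_inc)+
  then have "visible S u z" "visible S v z" using zf unfolding visible_def by blast+
  then show ?thesis using that[of z] z zx by (simp add: insert_commute)
qed

end

section \<open>Planarity\<close>

text \<open>The bisectors are unit vectors with sum zero. Thus \<open>lin i\<close> is a signed
  distance from the line through the origin orthogonal to a bisector, and the cone \<open>i\<close>
  is where the other two functionals are nonpositive.\<close>

definition lin :: "nat \<Rightarrow> pt \<Rightarrow> real" where
  "lin i d = fst d * fst (bisector i) + snd d * snd (bisector i)"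

definition perm3 :: "nat \<Rightarrow> nat \<Rightarrow> nat \<Rightarrow> bool" where
  "perm3 i j k \<longleftrightarrow> (i, j, k) \<in> {(0, 1, 2), (0, 2, 1), (1, 0, 2), (1, 2, 0), (2, 0, 1), (2, 1, 0)}"

lemma perm3_cases:
  assumes "perm3 i j k"
    and "Q 0 1 2" "Q 0 2 1" "Q 1 0 2" "Q 1 2 0" "Q 2 0 1" "Q 2 1 0"
  shows "Q i j k"
  using assms unfolding perm3_def by auto

lemma perm3_swap: "perm3 i j k \<Longrightarrow> perm3 i k j" "perm3 i j k \<Longrightarrow> perm3 j i k"
  by (auto simp: perm3_def)

lemma perm3_less: "perm3 i j k \<Longrightarrow> i < 3" "perm3 i j k \<Longrightarrow> j < 3" "perm3 i j k \<Longrightarrow> k < 3"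
  by (auto simp: perm3_def)

lemma ex_perm3: "i < 3 \<Longrightarrow> \<exists>j k. perm3 i j k"
proof -
  assume "i < 3"
  then consider "i = 0" | "i = 1" | "i = 2" by linarith
  then show ?thesis unfolding perm3_def by cases blast+
qed

lemma proj_lin: "proj i u v = lin i (v - u)"
  by (simp add: proj_def lin_def)

lemma lin_add: "lin i (x + y) = lin i x + lin i y"
  and lin_diff: "lin i (x - y) = lin i x - lin i y"
  and lin_scale: "lin i (r *\<^sub>R x) = r * lin i x"
  by (simp_all add: lin_def algebra_simps)

lemmas lin_simps = lin_add lin_diff lin_scale

lemma lin_sum:
  assumes "perm3 i j k"
  shows "lin i d = - lin j d - lin k d"
  by (rule perm3_cases[OF assms]) (simp_all add: lin_def bisector_def algebra_simps)

lemma lin_norm: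
  assumes "perm3 i j k"
  shows "3 * (norm d)\<^sup>2 = 4 * ((lin j d)\<^sup>2 + lin j d * lin k d + (lin k d)\<^sup>2)"
proof -
  \<comment> \<open>In these scaled coordinates the three functionals have integer coefficients,
    which removes \<open>sqrt 3\<close> from the algebra.\<close>
  define p where "p = sqrt 3 / 2 * fst d"
  define q where "q = snd d / 2"
  have n: "(norm d)\<^sup>2 = (fst d)\<^sup>2 + (snd d)\<^sup>2" by (simp add: norm_prod_def)
  have "p\<^sup>2 = 3 / 4 * (fst d)\<^sup>2" by (simp add: p_def power_mult_distrib power_divide)
  moreover have "q\<^sup>2 = 1 / 4 * (snd d)\<^sup>2" by (simp add: q_def power_divide)
  ultimately have n: "3 * (norm d)\<^sup>2 = 4 * (p * p + 3 * (q * q))"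
    unfolding n by (simp add: power2_eq_square)
  have l: "lin 0 d = 2 * q" "lin 1 d = - p - q" "lin 2 d = p - q"
    by (simp_all add: lin_def bisector_def p_def q_def)
  show ?thesis
    unfolding n by (rule perm3_cases[OF assms]; unfold l; simp add: power2_eq_square algebra_simps)
qed

text \<open>The values of two functionals serve as oblique coordinates. Orientation tests in them
  agree with \<open>cross2\<close> up to the nonzero factor \<open>r\<close>, whose sign depends on
  the order of the indices.\<close>

lemma lin_cross2:
  assumes "perm3 i j k"
  obtains r where "r \<noteq> 0" "\<And>x y. lin j x * lin k y - lin k x * lin j y = r * cross2 x y"
proof -
  have "\<exists>r. r \<noteq> 0 \<and> (\<forall>x y. lin j x * lin k y - lin k x * lin j y = r * cross2 x y)"
  proof (rule perm3_cases[OF assms])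
    let ?P = "\<lambda>i j k r. r \<noteq> 0 \<and> (\<forall>x y. lin j x * lin k y - lin k x * lin j y = r * cross2 x y)"
    have "?P 0 1 2 (sqrt 3 / 2)" "?P 0 2 1 (- sqrt 3 / 2)" "?P 1 0 2 (- sqrt 3 / 2)"
      "?P 1 2 0 (sqrt 3 / 2)" "?P 2 0 1 (sqrt 3 / 2)" "?P 2 1 0 (- sqrt 3 / 2)"
      by (simp_all add: lin_def bisector_def cross2_def field_simps)
    then show "\<exists>r. ?P 0 1 2 r" "\<exists>r. ?P 0 2 1 r" "\<exists>r. ?P 1 0 2 r" "\<exists>r. ?P 1 2 0 r"
      "\<exists>r. ?P 2 0 1 r" "\<exists>r. ?P 2 1 0 r" by blast+
  qed
  then show ?thesis using that by blast
qed

lemma lin_eqI: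
  assumes "perm3 i j k" "lin j x = lin j y" "lin k x = lin k y"
  shows "x = y"
  using lin_norm[OF assms(1), of "x - y"] assms(2,3) by (simp add: lin_diff)

text \<open>For \<open>d = v - u\<close>, the square of \<open>sqrt 3 / 2 * norm d\<close> is
  \<open>lin i d\<close> squared minus \<open>lin j d * lin k d\<close>. The angle condition thus
  says that the product is nonnegative and the sum of its factors is nonpositive.\<close>

lemma in_cone_lin:
  assumes "perm3 i j k"
  shows "in_cone i u v \<longleftrightarrow> v \<noteq> u \<and> lin j (v - u) \<le> 0 \<and> lin k (v - u) \<le> 0"
proof -
  define d where "d = v - u"
  let ?n = "sqrt 3 / 2 * norm d"
  have f: "lin i d = - lin j d - lin k d" using lin_sum[OF assms] .
  have n: "?n\<^sup>2 = (lin i d)\<^sup>2 - lin j d * lin k d"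
    using lin_norm[OF assms, of d] unfolding f
    by (simp add: power_mult_distrib power_divide power2_eq_square field_simps)
  have n0: "?n \<ge> 0" by simp
  have "?n \<le> lin i d \<longleftrightarrow> lin j d \<le> 0 \<and> lin k d \<le> 0"
  proof
    assume le: "?n \<le> lin i d"
    then have "?n\<^sup>2 \<le> (lin i d)\<^sup>2" using n0 by (intro power_mono) auto
    then have "0 \<le> lin j d * lin k d" using n by linarith
    moreover have "lin j d + lin k d \<le> 0" using le n0 f by linarith
    ultimately show "lin j d \<le> 0 \<and> lin k d \<le> 0" by (auto simp: zero_le_mult_iff)
  next
    assume a: "lin j d \<le> 0 \<and> lin k d \<le> 0"
    then have "0 \<le> lin j d * lin k d" by (simp add: mult_nonpos_nonpos)
    then have "?n\<^sup>2 \<le> (lin i d)\<^sup>2" using n by linarith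
    moreover have "0 \<le> lin i d" using a f by linarith
    ultimately show "?n \<le> lin i d" by (rule power2_le_imp_le)
  qed
  moreover have "dist u v = norm d" by (simp add: d_def dist_norm norm_minus_commute)
  ultimately show ?thesis unfolding in_cone_def proj_lin d_def[symmetric] by auto
qed

context obstacle_setting
begin

lemma lin_vertices:
  assumes "i < 3" "a \<in> V" "b \<in> V" "a \<noteq> b"
  shows "lin i (b - a) \<noteq> 0"
proof -
  have *: "snd b - snd a \<noteq> 0" "snd b - snd a \<noteq> sqrt 3 * (fst b - fst a)"
    "snd b - snd a \<noteq> - sqrt 3 * (fst b - fst a)"
    using genpos assms unfolding general_position_def by blast+
  consider "i = 0" | "i = 1" | "i = 2" using assms(1) by linarith
  then show ?thesis
    using * by cases (auto simp: lin_def bisector_def field_simps)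
qed

lemma in_cone_vertices:
  assumes "perm3 i j k" "u \<in> V" "v \<in> V" "u \<noteq> v"
  shows "in_cone i u v \<longleftrightarrow> lin j (v - u) < 0 \<and> lin k (v - u) < 0"
  using in_cone_lin[OF assms(1), of u v] lin_vertices[of j u v] lin_vertices[of k u v]
    perm3_less[OF assms(1)] assms by auto

text \<open>Naming both indices besides \<open>i\<close> keeps the two sides of the cone apart;
  exchanging them is reflection in the bisector.\<close>

definition cone_edge :: "nat \<Rightarrow> nat \<Rightarrow> nat \<Rightarrow> pt \<Rightarrow> pt \<Rightarrow> bool" where
  "cone_edge i j k u v \<longleftrightarrow> perm3 i j k \<and> u \<in> V \<and> v \<in> V \<and> u \<noteq> v \<and> visible S u v \<and>
     lin j (v - u) < 0 \<and> lin k (v - u) < 0 \<and>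
     (\<forall>z\<in>V. z \<noteq> u \<longrightarrow> visible S u z \<longrightarrow> same_subcone S u v z \<longrightarrow>
       lin j (z - u) < 0 \<longrightarrow> lin k (z - u) < 0 \<longrightarrow> lin i (v - u) \<le> lin i (z - u))"

lemma cone_edge_swap: "cone_edge i j k u v \<Longrightarrow> cone_edge i k j u v"
  unfolding cone_edge_def using perm3_swap(1) by blast

lemma Ginf_iff:
  "(u, v) \<in> Ginf V S \<longleftrightarrow> (\<exists>i j k. cone_edge i j k u v)"
proof
  assume "(u, v) \<in> Ginf V S"
  then obtain i where i: "u \<in> V" "i < 3" "v \<in> vis_in_cone V S i u"
    "\<And>w. w \<in> vis_in_cone V S i u \<Longrightarrow> same_subcone S u v w \<Longrightarrow> proj i u v \<le> proj i u w"
    by (auto simp: Ginf_def)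
  obtain j k where p: "perm3 i j k" using ex_perm3[OF i(2)] by blast
  have v: "v \<in> V" "u \<noteq> v" "visible S u v" "in_cone i u v"
    using i(3) by (auto simp: vis_in_cone_def in_cone_def)
  have "lin i (v - u) \<le> lin i (z - u)"
    if "z \<in> V" "z \<noteq> u" "visible S u z" "same_subcone S u v z" "lin j (z - u) < 0" "lin k (z - u) < 0" for z
    using i(4)[of z] that in_cone_vertices[OF p i(1) that(1)] by (auto simp: vis_in_cone_def proj_lin)
  then have "cone_edge i j k u v"
    unfolding cone_edge_def using p i(1) v in_cone_vertices[OF p i(1) v(1,2)] by blast
  then show "\<exists>i j k. cone_edge i j k u v" by blast
next
  assume "\<exists>i j k. cone_edge i j k u v"
  then obtain i j k where e: "cone_edge i j k u v" by blast
  then have p: "perm3 i j k" and uv: "u \<in> V" "v \<in> V" "u \<noteq> v" "visible S u v" by (auto simp: cone_edge_def)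
  have "v \<in> vis_in_cone V S i u"
    using e in_cone_vertices[OF p uv(1-3)] by (simp add: vis_in_cone_def cone_edge_def)
  moreover have "proj i u v \<le> proj i u w" if w: "w \<in> vis_in_cone V S i u" "same_subcone S u v w" for w
  proof -
    have "w \<in> V" "w \<noteq> u" "visible S u w" "in_cone i u w" using w(1) by (auto simp: vis_in_cone_def in_cone_def)
    then show ?thesis
      using e w(2) in_cone_vertices[OF p uv(1), of w] unfolding cone_edge_def proj_lin by blast
  qed
  ultimately show "(u, v) \<in> Ginf V S"
    using uv perm3_less(1)[OF p] unfolding Ginf_def by blast
qed

lemma Ginf_subset_Vis: "Ginf V S \<subseteq> Vis V S"
proof (rule subrelI)
  fix u v assume "(u, v) \<in> Ginf V S"
  then show "(u, v) \<in> Vis V S" unfolding Ginf_iff by (auto simp: cone_edge_def Vis_def)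
qed

text \<open>The crossing gives \<open>u\<close> a vertex in the subcone of \<open>v\<close> within
  the triangle on \<open>u\<close>, \<open>c\<close> and \<open>y\<close>. Both \<open>c\<close> and
  \<open>y\<close> project closer to \<open>u\<close> than \<open>v\<close> does, so that vertex
  does too, against the choice of \<open>v\<close>.\<close>

lemma cone_edge_not_crossed:
  assumes e: "cone_edge i j k u v" and xy: "x \<in> V" "y \<in> V" "visible S x y" "{u, v} \<noteq> {x, y}"
    and c: "c \<in> open_segment u v" "c \<in> open_segment x y"
    and y: "lin j (y - u) < 0" "lin k (y - u) < 0" "lin i (y - u) < lin i (v - u)"
  shows False
proof -
  have p: "perm3 i j k" and uv: "u \<in> V" "v \<in> V" "u \<noteq> v" "visible S u v"
    and neg: "lin j (v - u) < 0" "lin k (v - u) < 0"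
    using e by (auto simp: cone_edge_def)
  have pos: "lin i (v - u) > 0" using neg lin_sum[OF p, of "v - u"] by linarith
  obtain s where s: "c = (1 - s) *\<^sub>R u + s *\<^sub>R v" "0 < s" "s < 1" using c(1) by (auto simp: in_segment)
  have cu: "c - u = s *\<^sub>R (v - u)" unfolding s(1) by (simp add: algebra_simps)
  obtain z where z: "z \<in> V" "z \<in> convex hull {u, c, y}" "z \<noteq> u" "visible S u z" "same_subcone S u v z"
    using crossing_subcone_vertex[OF uv(1,2) xy(1,2,4) uv(4) xy(3) c] by metis
  obtain a b where ab: "0 \<le> a" "0 \<le> b" "a + b \<le> 1" "z = bary u c y a b"
    using z(2) by (auto simp: in_triangle_iff)
  have zu: "z - u = a *\<^sub>R (s *\<^sub>R (v - u)) + b *\<^sub>R (y - u)"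
    unfolding ab(4) bary_def cu by simp
  have l: "lin m (z - u) = a * (s * lin m (v - u)) + b * lin m (y - u)" for m
    unfolding zu by (simp only: lin_simps)
  have "a * (s * lin j (v - u)) \<le> 0" "b * lin j (y - u) \<le> 0" "a * (s * lin k (v - u)) \<le> 0" "b * lin k (y - u) \<le> 0"
    using ab s neg y by (simp_all add: mult_nonneg_nonpos)
  then have "lin j (z - u) \<le> 0" "lin k (z - u) \<le> 0" unfolding l by linarith+
  moreover have "lin j (z - u) \<noteq> 0" "lin k (z - u) \<noteq> 0"
    using lin_vertices uv z perm3_less[OF p] by metis+
  ultimately have zn: "lin j (z - u) < 0" "lin k (z - u) < 0" by auto
  have lt: "s * lin i (v - u) < lin i (v - u)" using s pos by simp
  have "lin i (z - u) < lin i (v - u)"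
  proof (cases "a = 0 \<and> b = 0")
    case True
    then show ?thesis unfolding l using pos by simp
  next
    case False
    have "a * (s * lin i (v - u)) + b * lin i (y - u) < a * lin i (v - u) + b * lin i (v - u)"
    proof (cases "a = 0")
      case True
      then show ?thesis using False ab y(3) by simp
    next
      case a: False
      then have "a * (s * lin i (v - u)) < a * lin i (v - u)" using lt ab by simp
      moreover have "b * lin i (y - u) \<le> b * lin i (v - u)" using y(3) ab by (simp add: mult_left_mono)
      ultimately show ?thesis by linarith
    qed
    also have "\<dots> \<le> 1 * lin i (v - u)" using ab pos by (simp add: distrib_right[symmetric] del: mult_1)
    finally show ?thesis unfolding l by simp
  qed
  then show False using e z zn unfolding cone_edge_def by force
qed

text \<open>If \<open>y\<close> has the smaller value of \<open>lin i\<close>, then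
  \<open>y - u\<close> is a positive combination of \<open>v - u\<close> and \<open>y - x\<close>,
  both directions of the cone, so \<open>y\<close> lies in the cone of \<open>u\<close> and closer
  than \<open>v\<close>.\<close>

lemma cone_edges_same_cone:
  assumes e: "cone_edge i j k u v" "cone_edge i j k x y" and ne: "{u, v} \<noteq> {x, y}"
    and c: "c \<in> open_segment u v" "c \<in> open_segment x y"
  shows False
proof -
  have main: False if e: "cone_edge i j k u v" "cone_edge i j k x y" and ne: "{u, v} \<noteq> {x, y}"
    and c: "c \<in> open_segment u v" "c \<in> open_segment x y" and lt: "lin i y < lin i v" for u v x y
  proof -
    obtain s where s: "c = (1 - s) *\<^sub>R u + s *\<^sub>R v" "0 < s" "s < 1" using c(1) by (auto simp: in_segment)
    obtain r where r: "c = (1 - r) *\<^sub>R x + r *\<^sub>R y" "0 < r" "r < 1" using c(2) by (auto simp: in_segment)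
    have "y - u = s *\<^sub>R (v - u) + (1 - r) *\<^sub>R (y - x)"
      using s(1) r(1) by (simp add: algebra_simps)
    then have l: "lin m (y - u) = s * lin m (v - u) + (1 - r) * lin m (y - x)" for m
      by (simp only: lin_add lin_scale)
    have "lin j (y - u) < 0" "lin k (y - u) < 0"
      unfolding l using s r e unfolding cone_edge_def by (simp_all add: add_neg_neg mult_pos_neg)
    moreover have "lin i (y - u) < lin i (v - u)" using lt by (simp add: lin_diff)
    ultimately show False
      using cone_edge_not_crossed[OF e(1) _ _ _ ne c] e(2) unfolding cone_edge_def by blast
  qed
  have V: "u \<in> V" "v \<in> V" "x \<in> V" "y \<in> V" and p: "perm3 i j k" using e by (auto simp: cone_edge_def)
  have "v \<noteq> y" using crossing_distinct[OF V ne c] by blast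
  then have "lin i v \<noteq> lin i y"
    using lin_vertices[OF perm3_less(1)[OF p] V(4) V(2)] by (auto simp: lin_diff)
  then show False
    using main[OF e ne c] main[OF e(2,1) ne[symmetric] c(2,1)] by linarith
qed

text \<open>Exchanging the edges if necessary, \<open>lin k (x - u)\<close> is negative. Then
  \<open>x\<close> is a closer vertex in the cone of \<open>u\<close>, or \<open>v\<close> is a
  closer one in the cone of \<open>x\<close>, according to which of \<open>x\<close> and
  \<open>v\<close> has the smaller \<open>lin i\<close>.\<close>

lemma cone_edges_different_cones:
  assumes e: "cone_edge i j k u v" "cone_edge j i k x y" and ne: "{u, v} \<noteq> {x, y}"
    and c: "c \<in> open_segment u v" "c \<in> open_segment x y"
  shows False
proof -
  have main: False if e: "cone_edge i j k u v" "cone_edge j i k x y" and ne: "{u, v} \<noteq> {x, y}"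
    and c: "c \<in> open_segment u v" "c \<in> open_segment x y" and lt: "lin k (x - u) < 0" for i j u v x y
  proof -
    have p: "perm3 i j k" "perm3 j i k" and V: "u \<in> V" "v \<in> V" "x \<in> V" "y \<in> V"
      and vis: "visible S u v" "visible S x y" "visible S y x" "visible S v u"
      and neg: "lin j (v - u) < 0" "lin k (v - u) < 0" "lin i (y - x) < 0" "lin k (y - x) < 0"
      using e by (auto simp: cone_edge_def visible_def closed_segment_commute)
    have pos: "lin i (v - u) > 0" "lin j (y - x) > 0"
      using neg lin_sum[OF p(1), of "v - u"] lin_sum[OF p(2), of "y - x"] by linarith+
    obtain s where s: "c = (1 - s) *\<^sub>R u + s *\<^sub>R v" "0 < s" "s < 1" using c(1) by (auto simp: in_segment)
    obtain r where r: "c = (1 - r) *\<^sub>R x + r *\<^sub>R y" "0 < r" "r < 1" using c(2) by (auto simp: in_segment)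
    have "x - u = s *\<^sub>R (v - u) - r *\<^sub>R (y - x)"
      using s(1) r(1) by (simp add: algebra_simps)
    then have lx: "lin m (x - u) = s * lin m (v - u) - r * lin m (y - x)" for m
      by (simp only: lin_diff[of _ "_ *\<^sub>R _"] lin_scale)
    have "v - x = (1 - s) *\<^sub>R (v - u) + r *\<^sub>R (y - x)"
      using s(1) r(1) by (simp add: algebra_simps)
    then have lv: "lin m (v - x) = (1 - s) * lin m (v - u) + r * lin m (y - x)" for m
      by (simp only: lin_add lin_scale)
    have "v \<noteq> x" using crossing_distinct[OF V ne c] by blast
    then have "lin i v \<noteq> lin i x"
      using lin_vertices[OF perm3_less(1)[OF p(1)] V(3) V(2)] by (auto simp: lin_diff)
    then consider "lin i x < lin i v" | "lin i v < lin i x" by linarith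
    then show False
    proof cases
      case 1
      have "s * lin j (v - u) < 0" "0 < r * lin j (y - x)" using s r neg pos by (auto simp: mult_pos_neg)
      then have "lin j (x - u) < 0" unfolding lx by linarith
      moreover have "lin i (x - u) < lin i (v - u)" using 1 by (simp add: lin_diff)
      moreover have "{u, v} \<noteq> {y, x}" "c \<in> open_segment y x"
        using ne c(2) by (simp_all add: insert_commute open_segment_commute)
      ultimately show False
        using cone_edge_not_crossed[OF e(1) V(4,3) vis(3) _ c(1)] lt by blast
    next
      case 2
      have "(1 - s) * lin k (v - u) < 0" "r * lin k (y - x) < 0" using s r neg by (auto simp: mult_pos_neg)
      then have "lin k (v - x) < 0" unfolding lv by linarith
      moreover have "lin i (v - x) < 0" using 2 by (simp add: lin_diff)
      moreover have "lin j (v - x) < lin j (y - x)"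
      proof -
        have "(1 - s) * lin j (v - u) < 0" "r * lin j (y - x) < lin j (y - x)"
          using s r neg pos by (auto simp: mult_pos_neg)
        then show ?thesis unfolding lv by linarith
      qed
      ultimately show False
        using cone_edge_not_crossed[OF e(2) V(1,2) vis(1) ne[symmetric] c(2,1)] by blast
    qed
  qed
  have V: "u \<in> V" "v \<in> V" "x \<in> V" "y \<in> V" and p: "perm3 i j k" using e by (auto simp: cone_edge_def)
  have "u \<noteq> x" using crossing_distinct[OF V ne c] by blast
  then have "lin k (x - u) \<noteq> 0"
    using lin_vertices[OF perm3_less(3)[OF p] V(1) V(3)] by blast
  then show False
    using main[OF e ne c] main[OF e(2,1) ne[symmetric] c(2,1)] unfolding lin_diff by linarith
qed

lemma plane_Ginf: "plane (Ginf V S)"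
  unfolding plane_def
proof (clarify, rule ccontr)
  fix u1 u2 v1 v2 x1 x2 y1 y2
  assume "((u1, u2), (v1, v2)) \<in> Ginf V S" "((x1, x2), (y1, y2)) \<in> Ginf V S"
    and ne: "{(u1, u2), (v1, v2)} \<noteq> {(x1, x2), (y1, y2)}"
    and "open_segment (u1, u2) (v1, v2) \<inter> open_segment (x1, x2) (y1, y2) \<noteq> {}"
  then obtain i j k i' j' k' c where e: "cone_edge i j k (u1, u2) (v1, v2)" "cone_edge i' j' k' (x1, x2) (y1, y2)"
    and c: "c \<in> open_segment (u1, u2) (v1, v2)" "c \<in> open_segment (x1, x2) (y1, y2)"
    unfolding Ginf_iff by blast
  have p: "perm3 i j k" "perm3 i' j' k'" using e by (auto simp: cone_edge_def)
  have "(i', j', k') \<in> {(i, j, k), (i, k, j), (j, i, k), (j, k, i), (k, i, j), (k, j, i)}"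
    using p unfolding perm3_def by auto
  then show False
    using cone_edges_same_cone[OF e(1) _ ne c] cone_edges_different_cones[OF e(1) _ ne c]
      cone_edges_different_cones[OF cone_edge_swap[OF e(1)] _ ne c] e(2) cone_edge_swap[OF e(2)] by auto
qed

end

section \<open>Path lengths\<close>

text \<open>Upper bounds witnessed by a walk compose by addition in the reals, without infima or
  infinite values.\<close>

definition reach :: "(pt \<times> pt) set \<Rightarrow> pt \<Rightarrow> pt \<Rightarrow> real \<Rightarrow> bool" where
  "reach E x y l \<longleftrightarrow> (\<exists>ps\<in>walks E x y. walk_len ps \<le> l)"

lemma reach_mono: "reach E x y l \<Longrightarrow> l \<le> m \<Longrightarrow> reach E x y m"
  unfolding reach_def by force

lemma walk_len_Cons:
  assumes "ps \<noteq> []"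
  shows "walk_len (x # ps) = dist x (hd ps) + walk_len ps"
proof -
  obtain n where n: "length ps = Suc n" using assms by (cases ps) auto
  have "walk_len (x # ps) = (\<Sum>k<Suc n. dist ((x # ps) ! k) (ps ! k))"
    by (simp add: walk_len_def n)
  also have "\<dots> = dist x (hd ps) + (\<Sum>k<n. dist (ps ! k) (ps ! Suc k))"
    unfolding sum.lessThan_Suc_shift using assms by (simp add: hd_conv_nth)
  finally show ?thesis by (simp add: walk_len_def n)
qed

lemma reach_refl: "reach E x x 0"
  unfolding reach_def walks_def by (rule bexI[of _ "[x]"]) (auto simp: walk_len_def)

lemma reach_Cons:
  assumes "adj E x y" "reach E y z l"
  shows "reach E x z (dist x y + l)"
proof -
  obtain ps where ps: "ps \<in> walks E y z" "walk_len ps \<le> l" using assms(2) by (auto simp: reach_def)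
  then have ne: "ps \<noteq> []" "hd ps = y" by (auto simp: walks_def)
  have "adj E ((x # ps) ! k) ((x # ps) ! Suc k)" if "Suc k < length (x # ps)" for k
    using that ps ne assms(1) by (cases k) (auto simp: walks_def hd_conv_nth)
  then have "x # ps \<in> walks E x z" using ps(1) ne by (auto simp: walks_def)
  moreover have "walk_len (x # ps) \<le> dist x y + l" using ps ne walk_len_Cons by simp
  ultimately show ?thesis unfolding reach_def by blast
qed

lemma walk_induct:
  assumes "ps \<in> walks E x y" "Q y 0"
    and step: "\<And>x z l. adj E x z \<Longrightarrow> Q z l \<Longrightarrow> Q x (dist x z + l)"
  shows "Q x (walk_len ps)"
  using assms(1)
proof (induction ps arbitrary: x)
  case Nil
  then show ?case by (simp add: walks_def)
next
  case (Cons a ps)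
  have a: "a = x" using Cons.prems by (simp add: walks_def)
  show ?case
  proof (cases "ps = []")
    case True
    then show ?thesis using Cons.prems assms(2) a by (simp add: walks_def walk_len_def)
  next
    case False
    have st: "adj E ((a # ps) ! k) ((a # ps) ! Suc k)" if "Suc k < length (a # ps)" for k
      using Cons.prems that by (auto simp: walks_def)
    have "adj E (ps ! k) (ps ! Suc k)" if "Suc k < length ps" for k
      using st[of "Suc k"] that by simp
    then have "ps \<in> walks E (hd ps) y" using Cons.prems False by (auto simp: walks_def)
    then have "Q (hd ps) (walk_len ps)" by (rule Cons.IH)
    moreover have "adj E x (hd ps)" using st[of 0] False a by (simp add: hd_conv_nth)
    ultimately show ?thesis
      using step walk_len_Cons[OF False, of a] a by simp
  qed
qed

lemma reach_trans:
  assumes "reach E x y l" "reach E y z m"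
  shows "reach E x z (l + m)"
proof -
  obtain ps where ps: "ps \<in> walks E x y" "walk_len ps \<le> l" using assms(1) by (auto simp: reach_def)
  have "reach E x z (walk_len ps + m)"
    using ps(1)
    by (rule walk_induct[where Q = "\<lambda>x l. reach E x z (l + m)"])
      (use assms(2) reach_Cons in \<open>auto simp: add.assoc\<close>)
  then show ?thesis using ps(2) by (elim reach_mono) simp
qed

lemma reach_edge: "adj E x y \<Longrightarrow> reach E x y (dist x y)"
  using reach_Cons[OF _ reach_refl, of E x y] by simp

lemma reach_sym:
  assumes "reach E x y l"
  shows "reach E y x l"
proof -
  obtain ps where ps: "ps \<in> walks E x y" "walk_len ps \<le> l" using assms by (auto simp: reach_def)
  have "reach E y x' (dist x' z + m)" if "adj E x' z" "reach E y z m" for x' z m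
    using reach_trans[OF that(2) reach_edge, of x'] that(1)
    by (simp add: adj_def dist_commute add.commute disj_commute)
  with ps(1) reach_refl have "reach E y x (walk_len ps)"
    by (rule walk_induct[where Q = "\<lambda>x l. reach E y x l"])
  then show ?thesis using ps(2) by (rule reach_mono)
qed

lemma is_spannerI:
  assumes "H \<subseteq> G" "0 < t" and step: "\<And>x y. (x, y) \<in> G \<Longrightarrow> reach H x y (t * dist x y)"
  shows "is_spanner t V H G"
  unfolding is_spanner_def
proof (intro conjI ballI)
  fix x y
  have "reach H x' y (t * (dist x' z + l))" if "adj G x' z" "reach H z y (t * l)" for x' z l
  proof -
    have "reach H x' z (t * dist x' z)"
      using that(1) step reach_sym unfolding adj_def by (metis dist_commute)
    then show ?thesis using reach_trans[OF _ that(2)] by (simp add: distrib_left)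
  qed
  then have main: "reach H x y (t * walk_len ps)" if "ps \<in> walks G x y" for ps
    using walk_induct[OF that, of "\<lambda>x l. reach H x y (t * l)"] reach_refl by simp
  have le: "gdist H x y \<le> ereal t * ereal (walk_len ps)" if ps: "ps \<in> walks G x y" for ps
  proof -
    obtain qs where "qs \<in> walks H x y" "walk_len qs \<le> t * walk_len ps"
      using main[OF ps] by (auto simp: reach_def)
    then show ?thesis unfolding gdist_def by (intro INF_lower2) auto
  qed
  \<comment> \<open>With the factor moved to the left, the bound passes to the infimum over walks of
    \<open>G\<close>, including the empty infimum when there is none.\<close>
  have "gdist H x y / ereal t \<le> gdist G x y"
    unfolding gdist_def[of G]
  proof (intro INF_greatest)
    fix ps assume "ps \<in> walks G x y"
    then show "gdist H x y / ereal t \<le> ereal (walk_len ps)"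
      using le assms(2) by (subst ereal_divide_le_pos) auto
  qed
  then show "gdist H x y \<le> ereal t * gdist G x y"
    using assms(2) by (simp add: ereal_divide_le_pos)
qed (fact assms(1))

section \<open>Subcones\<close>

lemma sector_commute: "sector u v w = sector u w v"
  unfolding sector_def by (auto simp: add.commute add.left_commute) (metis add.assoc add.commute)+

lemma sector_subset:
  assumes "z - u = p *\<^sub>R (v - u) + q *\<^sub>R (w - u)" "0 \<le> p" "0 \<le> q"
  shows "sector u z w \<subseteq> sector u v w" "sector u v z \<subseteq> sector u v w"
proof -
  have "u + s *\<^sub>R (z - u) + t *\<^sub>R (w - u) = u + (s * p) *\<^sub>R (v - u) + (s * q + t) *\<^sub>R (w - u)" for s t
    unfolding assms(1) by (simp add: algebra_simps)
  then show "sector u z w \<subseteq> sector u v w"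
    unfolding sector_def using assms(2,3)
    by (smt (verit, ccfv_threshold) add_nonneg_nonneg mem_Collect_eq mult_nonneg_nonneg subsetI)
  have "u + s *\<^sub>R (v - u) + t *\<^sub>R (z - u) = u + (s + t * p) *\<^sub>R (v - u) + (t * q) *\<^sub>R (w - u)" for s t
    unfolding assms(1) by (simp add: algebra_simps)
  then show "sector u v z \<subseteq> sector u v w"
    unfolding sector_def using assms(2,3)
    by (smt (verit, ccfv_threshold) add_nonneg_nonneg mem_Collect_eq mult_nonneg_nonneg subsetI)
qed

lemma same_subcone_mono:
  assumes "same_subcone S u v w" "sector u v' w' \<subseteq> sector u v w"
  shows "same_subcone S u v' w'"
proof -
  have "closure (sector u v' w' \<inter> I) \<subseteq> closure (sector u v w \<inter> I)" for I
    using assms(2) by (intro closure_mono) blast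
  then show ?thesis using assms(1) unfolding same_subcone_def by blast
qed

lemma same_subcone_sym: "same_subcone S u v w \<Longrightarrow> same_subcone S u w v"
  unfolding same_subcone_def by (simp add: sector_commute)

text \<open>Closure commutes with finite unions, so an obstacle reaching \<open>u\<close> in the
  large sector reaches it in one of the two covering sectors.\<close>

lemma same_subcone_trans:
  assumes "same_subcone S u a b" "same_subcone S u b c"
    and sub: "sector u a c \<subseteq> sector u a b \<union> sector u b c"
  shows "same_subcone S u a c"
proof -
  have "closure (sector u a c \<inter> I) \<subseteq> closure (sector u a b \<inter> I) \<union> closure (sector u b c \<inter> I)" for I
    unfolding closure_Un[symmetric] using sub by (intro closure_mono) blast
  then show ?thesis using assms(1,2) unfolding same_subcone_def by blast
qed

text \<open>The three directions lie in one open half-plane, where they are linearly ordered by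
  angle; \<open>b\<close> may lie between \<open>a\<close> and \<open>c\<close> or beyond
  either.\<close>

lemma sector_subset_Un:
  assumes nd: "cross2 (a - u) (c - u) \<noteq> 0"
    and pos: "0 < lin i (a - u)" "0 < lin i (b - u)" "0 < lin i (c - u)"
  shows "sector u a c \<subseteq> sector u a b \<union> sector u b c"
proof
  fix x assume "x \<in> sector u a c"
  then obtain s t where st: "0 \<le> s" "0 \<le> t" "x = u + s *\<^sub>R (a - u) + t *\<^sub>R (c - u)"
    by (auto simp: sector_def)
  obtain p q where "b = bary u a c p q" using ex_bary[OF nd] by blast
  then have b: "b - u = p *\<^sub>R (a - u) + q *\<^sub>R (c - u)" by (simp add: bary_def)
  have "0 < p * lin i (a - u) + q * lin i (c - u)" using pos(2) unfolding b by (simp only: lin_simps)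
  then have pq: "0 < p \<or> 0 < q"
    using pos by (smt (verit) mult_nonpos_nonneg)
  \<comment> \<open>The test decides on which side of the ray through \<open>b\<close> the point
    \<open>x\<close> lies, hence which smaller sector contains it.\<close>
  consider "0 < q" "t * p \<le> s * q" | "0 < p" "s * q \<le> t * p"
  proof (cases "t * p \<le> s * q")
    case True
    then show ?thesis using that pq st by (cases "0 < q") (smt (verit) mult_nonneg_nonneg mult_nonneg_nonpos)+
  next
    case False
    then show ?thesis using that pq st by (cases "0 < p") (smt (verit) mult_nonneg_nonneg mult_nonneg_nonpos)+
  qed
  then show "x \<in> sector u a b \<union> sector u b c"
  proof cases
    case 1
    have "x = u + (s - t * p / q) *\<^sub>R (a - u) + (t / q) *\<^sub>R (b - u)"
      unfolding st(3) b using 1 by (simp add: algebra_simps)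
    moreover have "0 \<le> s - t * p / q" "0 \<le> t / q" using 1 st by (auto simp: field_simps)
    ultimately have "x \<in> sector u a b" unfolding sector_def by blast
    then show ?thesis by blast
  next
    case 2
    have "x = u + (s / p) *\<^sub>R (b - u) + (t - s * q / p) *\<^sub>R (c - u)"
      unfolding st(3) b using 2 by (simp add: algebra_simps)
    moreover have "0 \<le> s / p" "0 \<le> t - s * q / p" using 2 st by (auto simp: field_simps)
    ultimately have "x \<in> sector u b c" unfolding sector_def by blast
    then show ?thesis by blast
  qed
qed

text \<open>The degenerate sector is a ray that coincides near \<open>u\<close> with the visible
  segment.\<close>

lemma same_subcone_refl:
  assumes "visible S u w"
  shows "same_subcone S u w w"
  unfolding same_subcone_def
proof safe
  fix P assume P: "P \<in> S" and cl: "u \<in> closure (sector u w w \<inter> obst_interior P)"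
  have uI: "u \<notin> obst_interior P" using assms P by (auto simp: visible_def)
  show False
  proof (cases "u = w")
    case True
    then have "sector u w w \<subseteq> {u}" by (auto simp: sector_def)
    then have "sector u w w \<inter> obst_interior P = {}" using uI by blast
    then show False using cl by simp
  next
    case False
    then have "0 < dist w u" by simp
    then obtain x where x: "x \<in> sector u w w" "x \<in> obst_interior P" "dist x u < dist w u"
      using cl unfolding closure_approachable by blast
    obtain s t where st: "0 \<le> s" "0 \<le> t" "x = u + s *\<^sub>R (w - u) + t *\<^sub>R (w - u)"
      using x(1) by (auto simp: sector_def)
    have xu: "x - u = (s + t) *\<^sub>R (w - u)" unfolding st(3) by (simp add: algebra_simps)
    have "(s + t) * norm (w - u) < 1 * norm (w - u)"
      using x(3) st unfolding dist_norm xu by simp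
    then have "s + t < 1" by (rule mult_right_less_imp_less) simp
    moreover have "x = (1 - (s + t)) *\<^sub>R u + (s + t) *\<^sub>R w" using st(3) by (simp add: algebra_simps)
    ultimately have "x \<in> closed_segment u w" unfolding in_segment using st(1,2) by (smt (verit))
    then show False using assms P x(2) by (auto simp: visible_def)
  qed
qed

text \<open>A linear functional that is positive on two directions is positive on every direction
  between them. The identity writes the middle direction as a positive combination of the outer
  ones.\<close>

lemma between_directions:
  fixes a b a1 b1 a2 b2 p q :: real
  assumes "a * b1 < b * a1" "a * b2 < b * a2" "a2 * b1 < b2 * a1"
    and "0 < p * a + q * b" "0 < p * a1 + q * b1"
  shows "0 < p * a2 + q * b2"
proof -
  have "(b * a1 - a * b1) * (p * a2 + q * b2) =
      (b2 * a1 - a2 * b1) * (p * a + q * b) + (b * a2 - a * b2) * (p * a1 + q * b1)"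
    by algebra
  also have "\<dots> > 0"
    by (rule add_pos_pos; rule mult_pos_pos) (use assms in auto)
  finally show ?thesis using assms(1) by (simp add: zero_less_mult_iff)
qed

text \<open>The three inequalities are orientation tests against the sides; \<open>s\<close> and
  \<open>t\<close> are the barycentric coordinates from Cramer's rule.\<close>

lemma in_triangle_coords:
  assumes p: "perm3 i j k"
    and "a = (\<lambda>x. - lin j (x - u))" and "b = (\<lambda>x. - lin k (x - u))"
    and v: "a v * b w < a w * b v"
    and x: "a v * b x \<le> a x * b v" "a x * b w \<le> a w * b x"
      "(b x - b v) * (a w - a v) \<le> (a x - a v) * (b w - b v)"
  shows "x \<in> convex hull {u, v, w}"
proof -
  define D where "D = a w * b v - a v * b w"
  define s where "s = (a w * b x - a x * b w) / D"
  define t where "t = (a x * b v - a v * b x) / D"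
  have D: "D > 0" using v by (simp add: D_def)
  have "0 \<le> s" "0 \<le> t" using x D by (simp_all add: s_def t_def)
  moreover have "s + t \<le> 1"
  proof -
    have "(a w * b x - a x * b w) + (a x * b v - a v * b x) \<le> D"
      unfolding D_def using x(3) by (simp add: algebra_simps)
    then show ?thesis using D by (simp add: s_def t_def add_divide_distrib[symmetric])
  qed
  moreover have "x = bary u v w s t"
  proof -
    have "D * (s * a v + t * a w) = D * a x"
      using D by (simp add: s_def t_def distrib_left) (simp add: D_def algebra_simps)
    then have 1: "s * a v + t * a w = a x" using D by simp
    have "D * (s * b v + t * b w) = D * b x"
      using D by (simp add: s_def t_def distrib_left) (simp add: D_def algebra_simps)
    then have 2: "s * b v + t * b w = b x" using D by simp
    have "x - u = s *\<^sub>R (v - u) + t *\<^sub>R (w - u)"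
      by (rule lin_eqI[OF p]) (use 1 2 in \<open>simp_all only: lin_add lin_scale assms(2,3)\<close>; linarith)+
    then show ?thesis by (simp add: bary_def algebra_simps)
  qed
  ultimately show ?thesis unfolding in_triangle_iff by blast
qed

section \<open>The spanning ratio\<close>

text \<open>The triangle inequality for the route around a corner of the equilateral
  triangle.\<close>

lemma norm_le_cost:
  assumes "perm3 i j k" "lin j d \<le> 0" "lin k d \<le> 0"
  shows "norm d \<le> 2 / sqrt 3 * (2 * - lin j d + - lin k d)"
proof -
  define A B where "A = - lin j d" and "B = - lin k d"
  have AB: "0 \<le> A" "0 \<le> B" using assms by (auto simp: A_def B_def)
  have "(sqrt 3 * norm d)\<^sup>2 = 4 * (A\<^sup>2 + A * B + B\<^sup>2)"
    using lin_norm[OF assms(1), of d] by (simp add: power_mult_distrib A_def B_def)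
  also have "\<dots> \<le> (2 * (2 * A + B))\<^sup>2" using AB by (simp add: power2_eq_square algebra_simps)
  finally have "sqrt 3 * norm d \<le> 2 * (2 * A + B)" by (rule power2_le_imp_le) (use AB in simp)
  then show ?thesis by (simp add: A_def B_def field_simps)
qed

text \<open>Source of the ratio 2: \<open>4 * (A * A + A * B + B * B)\<close> exceeds the squares of
  \<open>2 * A + B\<close> and \<open>A + 2 * B\<close> by \<open>3 * B * B\<close> and
  \<open>3 * A * A\<close>.\<close>

lemma cost_le_norm:
  assumes "perm3 i j k"
  shows "2 / sqrt 3 * max (2 * - lin j d + - lin k d) (- lin j d + 2 * - lin k d) \<le> 2 * norm d"
proof -
  define A B where "A = - lin j d" and "B = - lin k d"
  have n: "(sqrt 3 * norm d)\<^sup>2 = 4 * (A\<^sup>2 + A * B + B\<^sup>2)"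
    using lin_norm[OF assms(1), of d] by (simp add: power_mult_distrib A_def B_def)
  have "(2 * A + B)\<^sup>2 \<le> (sqrt 3 * norm d)\<^sup>2" "(A + 2 * B)\<^sup>2 \<le> (sqrt 3 * norm d)\<^sup>2"
    unfolding n by (simp_all add: power2_eq_square algebra_simps)
  then have "2 * A + B \<le> sqrt 3 * norm d" "A + 2 * B \<le> sqrt 3 * norm d"
    by (auto intro: power2_le_imp_le)
  then have "max (2 * A + B) (A + 2 * B) \<le> sqrt 3 * norm d" by simp
  then show ?thesis unfolding A_def[symmetric] B_def[symmetric] by (simp add: field_simps)
qed

context obstacle_setting
begin

text \<open>Among the vertices of the cone at \<open>u\<close> that see \<open>u\<close> in the subcone of \<open>w\<close>, none lies in the
  half of the equilateral triangle of \<open>u\<close> and \<open>w\<close> on the side of the ray where \<open>lin k\<close>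
  vanishes.\<close>

definition side_empty :: "nat \<Rightarrow> nat \<Rightarrow> nat \<Rightarrow> pt \<Rightarrow> pt \<Rightarrow> bool" where
  "side_empty i j k u w \<longleftrightarrow> (\<forall>z\<in>V. z \<noteq> u \<longrightarrow> visible S u z \<longrightarrow> same_subcone S u w z \<longrightarrow>
     lin j (z - u) < 0 \<longrightarrow> lin k (z - u) < 0 \<longrightarrow> lin i (z - u) < lin i (w - u) \<longrightarrow>
     lin j (z - u) * lin k (w - u) \<le> lin j (w - u) * lin k (z - u))"

text \<open>The prescribed route avoids the empty half: emptiness next to the ray where
  \<open>lin k\<close> vanishes yields \<open>2 * A + B\<close>, the route through the corner on the
  ray where \<open>lin j\<close> vanishes.\<close>

definition short_path :: "nat \<Rightarrow> nat \<Rightarrow> nat \<Rightarrow> pt \<Rightarrow> pt \<Rightarrow> bool" where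
  "short_path i j k u w \<longleftrightarrow> (let A = - lin j (w - u); B = - lin k (w - u) in
     reach (Ginf V S) u w (2 / sqrt 3 * max (2 * A + B) (A + 2 * B)) \<and>
     (side_empty i j k u w \<longrightarrow> reach (Ginf V S) u w (2 / sqrt 3 * (2 * A + B))) \<and>
     (side_empty i k j u w \<longrightarrow> reach (Ginf V S) u w (2 / sqrt 3 * (A + 2 * B))))"

end

section \<open>The convex chain in one cone\<close>

locale cone_pair = obstacle_setting V S for V S +
  fixes i j k :: nat and u w :: pt
  assumes perm: "perm3 i j k" and uV: "u \<in> V" and wV: "w \<in> V" and vis_uw: "visible S u w"
    and neg_j: "lin j (w - u) < 0" and neg_k: "lin k (w - u) < 0"
begin

text \<open>Oblique coordinates centred at \<open>u\<close>: the cone is the positive quadrant, and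
  \<open>a x + b x\<close> is the height that the closest vertex minimises.\<close>

definition a :: "pt \<Rightarrow> real" where "a x = - lin j (x - u)"
definition b :: "pt \<Rightarrow> real" where "b x = - lin k (x - u)"

lemma lin_ab: "lin j (x - y) = a y - a x" "lin k (x - y) = b y - b x"
  "lin i (x - y) = a x + b x - (a y + b y)"
  using lin_sum[OF perm, of "x - y"] by (simp_all add: a_def b_def lin_diff)

lemma ab_u: "a u = 0" "b u = 0"
  by (simp_all add: a_def b_def lin_def)

lemma ab_w: "0 < a w" "0 < b w"
  using neg_j neg_k by (simp_all add: a_def b_def)

lemma ab_distinct:
  assumes "x \<in> V" "y \<in> V" "x \<noteq> y"
  shows "a x \<noteq> a y" "b x \<noteq> b y" "a x + b x \<noteq> a y + b y"
  using lin_vertices[of i x y] lin_vertices[of j x y] lin_vertices[of k x y] perm3_less[OF perm] assms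
  unfolding lin_ab by auto

lemma ab_cross2:
  obtains r where "r \<noteq> 0" "\<And>x y x' y'. (a x - a y) * (b x' - b y') - (b x - b y) * (a x' - a y')
    = r * cross2 (x - y) (x' - y')"
proof -
  obtain r where r: "r \<noteq> 0" "\<And>x y. lin j x * lin k y - lin k x * lin j y = r * cross2 x y"
    using lin_cross2[OF perm] by blast
  have "(a x - a y) * (b x' - b y') - (b x - b y) * (a x' - a y') = r * cross2 (x - y) (x' - y')"
    for x y x' y'
    unfolding r(2)[symmetric] lin_ab by algebra
  then show ?thesis using that r(1) by blast
qed

lemma ab_noncollinear:
  assumes "p \<in> V" "x \<in> V" "y \<in> V" "p \<noteq> x" "p \<noteq> y" "x \<noteq> y"
  shows "(a x - a p) * (b y - b p) \<noteq> (b x - b p) * (a y - a p)"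
proof -
  obtain r where r: "r \<noteq> 0" "\<And>x y x' y'. (a x - a y) * (b x' - b y') - (b x - b y) * (a x' - a y')
    = r * cross2 (x - y) (x' - y')" using ab_cross2 by blast
  have "(a x - a p) * (b y - b p) - (b x - b p) * (a y - a p) \<noteq> 0"
    unfolding r(2) using r(1) cross2_vertices[OF assms] by simp
  then show ?thesis by simp
qed

text \<open>The vertices still available to a chain at \<open>v\<close>. They include
  \<open>w\<close> until it is reached and shrink at every step, so the chain is finite.\<close>

definition X :: "pt \<Rightarrow> pt set" where "X v = V \<inter> convex hull {u, v, w} - {u, v}"

text \<open>The last inequality fixes the side of the ray \<open>u w\<close>; the other side is
  obtained by exchanging \<open>j\<close> and \<open>k\<close>.\<close>

definition chain_vertex :: "pt \<Rightarrow> bool" where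
  "chain_vertex v \<longleftrightarrow> v \<in> V \<and> 0 < a v \<and> 0 < b v \<and> visible S u v \<and> same_subcone S u v w \<and>
     v \<noteq> w \<and> a v * b w < a w * b v"

lemma hull_coords:
  assumes "x \<in> convex hull {u, v, v'}"
  obtains p q where "0 \<le> p" "0 \<le> q" "p + q \<le> 1" "x - u = p *\<^sub>R (v - u) + q *\<^sub>R (v' - u)"
    "a x = p * a v + q * a v'" "b x = p * b v + q * b v'"
proof -
  obtain p q where pq: "0 \<le> p" "0 \<le> q" "p + q \<le> 1" "x = bary u v v' p q"
    using assms by (auto simp: in_triangle_iff)
  have xu: "x - u = p *\<^sub>R (v - u) + q *\<^sub>R (v' - u)" unfolding pq(4) bary_def by simp
  have "a x = p * a v + q * a v'" "b x = p * b v + q * b v'"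
    unfolding a_def b_def xu by (simp_all add: lin_add lin_scale)
  then show ?thesis using that pq xu by blast
qed

lemma X_coords:
  assumes v: "chain_vertex v" and x: "x \<in> X v"
  obtains p q where "0 \<le> p" "0 < q" "p + q \<le> 1" "x = w \<or> 0 < p" "x - u = p *\<^sub>R (v - u) + q *\<^sub>R (w - u)"
    "a x = p * a v + q * a w" "b x = p * b v + q * b w"
proof -
  have vV: "v \<in> V" using v by (simp add: chain_vertex_def)
  have xV: "x \<in> V" "x \<noteq> u" "x \<noteq> v" "x \<in> convex hull {u, v, w}" using x by (auto simp: X_def)
  obtain p q where pq: "0 \<le> p" "0 \<le> q" "p + q \<le> 1" "x - u = p *\<^sub>R (v - u) + q *\<^sub>R (w - u)"
    "a x = p * a v + q * a w" "b x = p * b v + q * b w" using hull_coords[OF xV(4)] .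
  have "q \<noteq> 0"
  proof
    assume "q = 0"
    then have "x = (1 - p) *\<^sub>R u + p *\<^sub>R v" using pq(4) by (simp add: algebra_simps)
    then have "x \<in> closed_segment u v" unfolding in_segment using pq \<open>q = 0\<close> by auto
    then show False using vertex_in_closed_segment[OF uV vV xV(1)] xV by blast
  qed
  moreover have "x = w \<or> p \<noteq> 0"
  proof (rule ccontr)
    assume "\<not> (x = w \<or> p \<noteq> 0)"
    then have n: "x \<noteq> w" "p = 0" by auto
    then have "x = (1 - q) *\<^sub>R u + q *\<^sub>R w" using pq(4) by (simp add: algebra_simps)
    then have "x \<in> closed_segment u w" unfolding in_segment using pq n by auto
    then show False using vertex_in_closed_segment[OF uV wV xV(1)] xV n by blast
  qed
  ultimately show ?thesis using that[of p q] pq by auto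
qed

lemma X_pos:
  assumes v: "chain_vertex v" and x: "x \<in> X v"
  shows "x \<in> V" "0 < a x" "0 < b x" "a v * b x < a x * b v" "x = w \<or> a x * b w < a w * b x"
    "a v + b v < a w + b w \<Longrightarrow> a x + b x \<le> a w + b w"
proof -
  have vp: "0 < a v" "0 < b v" "a v * b w < a w * b v" using v by (auto simp: chain_vertex_def)
  show "x \<in> V" using x by (simp add: X_def)
  obtain p q where pq: "0 \<le> p" "0 < q" "p + q \<le> 1" "x = w \<or> 0 < p" "x - u = p *\<^sub>R (v - u) + q *\<^sub>R (w - u)"
    "a x = p * a v + q * a w" "b x = p * b v + q * b w" using X_coords[OF v x] .
  show "0 < a x" "0 < b x"
    unfolding pq using pq vp ab_w by (auto intro!: add_nonneg_pos mult_nonneg_nonneg mult_pos_pos)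
  have "a x * b v - a v * b x = q * (a w * b v - a v * b w)" unfolding pq by algebra
  then show "a v * b x < a x * b v" using pq(2) vp(3) by (metis diff_gt_0_iff_gt mult_pos_pos)
  have "a w * b x - a x * b w = p * (a w * b v - a v * b w)" unfolding pq by algebra
  then show "x = w \<or> a x * b w < a w * b x" using pq(4) vp(3) by (metis diff_gt_0_iff_gt mult_pos_pos)
  show "a x + b x \<le> a w + b w" if "a v + b v < a w + b w"
  proof -
    have "a x + b x = p * (a v + b v) + q * (a w + b w)" unfolding pq by algebra
    also have "\<dots> \<le> p * (a w + b w) + q * (a w + b w)" using mult_left_mono[OF less_imp_le[OF that] pq(1)] by simp
    also have "\<dots> \<le> 1 * (a w + b w)"
      unfolding distrib_right[symmetric] using pq ab_w by (intro mult_right_mono) auto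
    finally show ?thesis by simp
  qed
qed

text \<open>The last clause puts every other available vertex strictly beyond the line
  \<open>v z\<close> as seen from \<open>u\<close>. It yields both the convexity of the chain and
  the emptiness of the triangle on \<open>u\<close>, \<open>v\<close> and \<open>z\<close>.\<close>

definition next_vertex :: "pt \<Rightarrow> pt \<Rightarrow> bool" where
  "next_vertex v z \<longleftrightarrow> z \<in> X v \<and> visible S u z \<and> visible S v z \<and> same_subcone S u v z \<and>
     (z = w \<or> chain_vertex z) \<and>
     (\<forall>x\<in>X v. x \<noteq> z \<longrightarrow> (a x - a v) * (b z - b v) < (b x - b v) * (a z - a v))"

lemma ex_next_vertex:
  assumes v: "chain_vertex v"
  shows "\<exists>z. next_vertex v z"
proof -
  have vV: "v \<in> V" "v \<noteq> w" "visible S u v" "same_subcone S u v w" and vp: "0 < a v" "a v * b w < a w * b v"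
    using v by (auto simp: chain_vertex_def)
  have uv: "u \<noteq> v" "u \<noteq> w" using vp ab_w ab_u by auto
  obtain z where z: "z \<in> V" "z \<in> convex hull {u, v, w}" "z \<noteq> u" "z \<noteq> v"
    "visible S u z" "visible S v z" and
    ext: "\<And>x. \<lbrakk>x \<in> V; x \<in> convex hull {u, v, w}; x \<noteq> u; x \<noteq> v\<rbrakk> \<Longrightarrow>
      0 \<le> cross2 (z - v) (x - v) * cross2 (u - v) (w - v)"
    using subcone_triangle_step[OF uV vV(1) wV uv vV(2,3) vis_uw vV(4)] by blast
  have zX: "z \<in> X v" using z by (simp add: X_def)
  note zp = X_pos[OF v zX]
  obtain p q where pq: "0 \<le> p" "0 < q" "z - u = p *\<^sub>R (v - u) + q *\<^sub>R (w - u)" using X_coords[OF v zX] .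
  have sub: "same_subcone S u v z" "same_subcone S u z w"
    using same_subcone_mono[OF vV(4)] sector_subset[OF pq(3,1)] pq(2) by auto
  have "(a x - a v) * (b z - b v) < (b x - b v) * (a z - a v)" if x: "x \<in> X v" "x \<noteq> z" for x
  proof -
    have xV: "x \<in> V" "x \<in> convex hull {u, v, w}" "x \<noteq> u" "x \<noteq> v" using x by (auto simp: X_def)
    obtain r where r: "r \<noteq> 0" "\<And>x y x' y'. (a x - a y) * (b x' - b y') - (b x - b y) * (a x' - a y')
      = r * cross2 (x - y) (x' - y')" using ab_cross2 by blast
    \<comment> \<open>Squaring \<open>r\<close> transfers the inequality to oblique coordinates
      without knowledge of its sign.\<close>
    have "0 \<le> (r * r) * (cross2 (z - v) (x - v) * cross2 (u - v) (w - v))"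
      using ext[OF xV] by simp
    also have "\<dots> = (r * cross2 (z - v) (x - v)) * (r * cross2 (u - v) (w - v))" by (simp add: mult_ac)
    also have "\<dots> = ((a z - a v) * (b x - b v) - (b z - b v) * (a x - a v)) * (a w * b v - a v * b w)"
      unfolding r(2)[symmetric] ab_u by (simp add: algebra_simps)
    finally have "0 \<le> (a z - a v) * (b x - b v) - (b z - b v) * (a x - a v)"
      using vp(2) by (simp add: zero_le_mult_iff)
    moreover have "(a z - a v) * (b x - b v) \<noteq> (b z - b v) * (a x - a v)"
      using ab_noncollinear[of v z x] vV z xV x(2) by auto
    ultimately show ?thesis by (simp add: mult.commute)
  qed
  moreover have "z = w \<or> chain_vertex z"
    using zp z sub by (auto simp: chain_vertex_def)
  ultimately show ?thesis unfolding next_vertex_def using zX z sub by blast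
qed

lemma next_vertex_facts:
  assumes v: "chain_vertex v" and n: "next_vertex v z" and up: "a v + b v < a z + b z"
  shows "a v < a z" "a v * (b z - b v) < b v * (a z - a v)" "a z * (b z - b v) < b z * (a z - a v)"
proof -
  have vp: "0 < a v" "0 < b v" using v by (auto simp: chain_vertex_def)
  have zX: "z \<in> X v" using n by (simp add: next_vertex_def)
  show 1: "a v * (b z - b v) < b v * (a z - a v)" using X_pos(4)[OF v zX] by (simp add: algebra_simps)
  then show "a z * (b z - b v) < b z * (a z - a v)" by (simp add: algebra_simps)
  show "a v < a z"
  proof (rule ccontr)
    assume "\<not> a v < a z"
    then have "b v * (a z - a v) \<le> 0" "0 \<le> a v * (b z - b v)"
      using vp up by (auto simp: mult_nonneg_nonpos)
    then show False using 1 by linarith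
  qed
qed

lemma X_next_subset:
  assumes v: "chain_vertex v" and n: "next_vertex v z" and zw: "z \<noteq> w"
  shows "X z \<subseteq> X v - {z}"
proof
  fix x assume x: "x \<in> X z"
  have z: "chain_vertex z" and zX: "z \<in> X v" using n zw by (auto simp: next_vertex_def)
  have "x \<noteq> v" using X_pos(4)[OF z x] X_pos(4)[OF v zX] by auto
  moreover have "convex hull {u, z, w} \<subseteq> convex hull {u, v, w}"
    using zX by (intro hull_minimal) (auto simp: X_def hull_inc)
  ultimately show "x \<in> X v - {z}" using x by (auto simp: X_def)
qed

text \<open>Directions from \<open>z\<close> to the remaining vertices lie between those of \<open>z - u\<close> and \<open>z - v\<close>.\<close>

lemma next_vertex_directions:
  assumes v: "chain_vertex v" and n: "next_vertex v z" and x: "x \<in> X z" and zw: "z \<noteq> w"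
    and pos: "0 < p * a z + q * b z" "0 < p * (a z - a v) + q * (b z - b v)"
  shows "0 < p * (a x - a z) + q * (b x - b z)"
proof -
  have z: "chain_vertex z" and zX: "z \<in> X v" using n zw by (auto simp: next_vertex_def)
  have xz: "a z * b x < a x * b z" using X_pos(4)[OF z x] .
  have vz: "a v * b z < a z * b v" using X_pos(4)[OF v zX] .
  have xX: "x \<in> X v" "x \<noteq> z" using X_next_subset[OF v n zw] x by auto
  then have "(a x - a v) * (b z - b v) < (b x - b v) * (a z - a v)"
    using n xX by (simp add: next_vertex_def)
  then have 3: "(a x - a z) * (b z - b v) < (b x - b z) * (a z - a v)" by (simp add: algebra_simps)
  have 1: "a z * (b z - b v) < b z * (a z - a v)" using vz by (simp add: algebra_simps)
  have 2: "a z * (b x - b z) < b z * (a x - a z)" using xz by (simp add: algebra_simps)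
  show ?thesis using between_directions[OF 1 2 3 pos] .
qed

text \<open>The side conditions place \<open>x\<close> in the triangle on \<open>u\<close>,
  \<open>v\<close> and \<open>z\<close>, hence among the available vertices but on the wrong side of
  the line \<open>v z\<close>.\<close>

lemma triangle_uvz:
  assumes v: "chain_vertex v" and n: "next_vertex v z" and x: "x \<in> V" "x \<noteq> u" "x \<noteq> v" "x \<noteq> z"
    and side: "a v * b x \<le> a x * b v" "a x * b z \<le> a z * b x"
      "(b x - b v) * (a z - a v) \<le> (a x - a v) * (b z - b v)"
  shows False
proof -
  have zX: "z \<in> X v" using n by (simp add: next_vertex_def)
  have "x \<in> convex hull {u, v, z}"
    using in_triangle_coords[OF perm _ _ X_pos(4)[OF v zX] side] a_def b_def by blast
  moreover have "convex hull {u, v, z} \<subseteq> convex hull {u, v, w}"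
    using zX by (intro hull_minimal) (auto simp: X_def hull_inc)
  ultimately have "x \<in> X v" using x by (auto simp: X_def)
  then show False using n x(4) side(3) unfolding next_vertex_def by force
qed

text \<open>The lengths, scaled by half the square root of 3, of the two routes from \<open>u\<close> to \<open>x\<close>
  along the sides of their equilateral triangle.\<close>

definition lcost :: "pt \<Rightarrow> real" where "lcost x = 2 * a x + b x"
definition rcost :: "pt \<Rightarrow> real" where "rcost x = a x + 2 * b x"

text \<open>The induction hypothesis. It ranges over all three cones because a chain segment may
  leave the cone \<open>i\<close>.\<close>

definition smaller_short :: bool where
  "smaller_short \<longleftrightarrow> (\<forall>i' j' k' p q. perm3 i' j' k' \<longrightarrow> p \<in> V \<longrightarrow> q \<in> V \<longrightarrow> visible S p q \<longrightarrow>
     lin j' (q - p) < 0 \<longrightarrow> lin k' (q - p) < 0 \<longrightarrow> lin i' (q - p) < lin i (w - u) \<longrightarrow>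
     short_path i' j' k' p q)"

lemma smaller_shortD:
  assumes smaller_short "perm3 i' j' k'" "p \<in> V" "q \<in> V" "visible S p q"
    "lin j' (q - p) < 0" "lin k' (q - p) < 0" "lin i' (q - p) < lin i (w - u)"
  shows "short_path i' j' k' p q"
  using assms unfolding smaller_short_def by blast

text \<open>As \<open>b\<close> decreases, \<open>v\<close> lies in the cone \<open>j\<close> of
  \<open>z\<close>, so the hypothesis is applied to the reversed segment. The half-triangle that has
  to be empty falls into the triangle on \<open>u\<close>, \<open>v\<close> and \<open>z\<close>;
  the route past it costs exactly the increase of \<open>lcost\<close>.\<close>

lemma reach_next_down:
  assumes IH: smaller_short and v: "chain_vertex v" and n: "next_vertex v z"
    and up: "a v + b v < a z + b z" "a v + b v < a w + b w" and down: "b z < b v"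
  shows "reach (Ginf V S) v z (2 / sqrt 3 * (lcost z - lcost v))"
proof -
  have vV: "v \<in> V" and vp: "0 < a v" "0 < b v" using v by (auto simp: chain_vertex_def)
  have zX: "z \<in> X v" and vis: "visible S z v"
    using n by (auto simp: next_vertex_def visible_def closed_segment_commute)
  note zp = X_pos[OF v zX]
  note az = next_vertex_facts[OF v n up(1)]
  have "side_empty j i k z v"
    unfolding side_empty_def
  proof (intro ballI impI, rule ccontr)
    fix x assume x: "x \<in> V" "x \<noteq> z" "lin i (x - z) < 0" "lin k (x - z) < 0" "lin j (x - z) < lin j (v - z)"
      and "\<not> lin i (x - z) * lin k (v - z) \<le> lin i (v - z) * lin k (x - z)"
    then have "(b x - b z) * (a z - a v) < (a x - a z) * (b z - b v)"
      unfolding lin_ab by (simp add: algebra_simps)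
    then have s: "(b x - b v) * (a z - a v) < (a x - a v) * (b z - b v)" by (simp add: algebra_simps)
    have l: "b z < b x" "a x < a z" "a v < a x" using x unfolding lin_ab by linarith+
    have "a v * b x \<le> a x * b v"
    proof (rule ccontr)
      assume "\<not> a v * b x \<le> a x * b v"
      moreover have "a v * b v \<le> a x * b v" using l vp by simp
      ultimately have "a v * b v < a v * b x" by linarith
      then have "b v < b x" using vp by simp
      then have "0 < (b x - b v) * (a z - a v)" using az by simp
      moreover have "(a x - a v) * (b z - b v) < 0" using l down by (simp add: mult_pos_neg)
      ultimately show False using s by linarith
    qed
    moreover have "a x * b z \<le> a z * b x" using l zp vp by (intro mult_mono) auto
    moreover have "x \<noteq> u" "x \<noteq> v" using l vp ab_u by auto
    ultimately show False using triangle_uvz[OF v n x(1)] x(2) s by auto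
  qed
  moreover have "short_path j i k z v"
  proof (rule smaller_shortD[OF IH perm3_swap(2)[OF perm] zp(1) vV vis])
    show "lin i (v - z) < 0" "lin k (v - z) < 0" "lin j (v - z) < lin i (w - u)"
      unfolding lin_ab ab_u using up(1) down vp zp(3) zp(6)[OF up(2)] by linarith+
  qed
  ultimately have "reach (Ginf V S) z v (2 / sqrt 3 * (lcost z - lcost v))"
    unfolding short_path_def lin_ab Let_def lcost_def by (simp add: algebra_simps)
  then show ?thesis by (rule reach_sym)
qed

text \<open>A violating \<open>x\<close> lies on the side of \<open>u\<close> of the line
  \<open>v z\<close>. By extremality of \<open>z\<close> it is outside the triangle on
  \<open>u\<close>, \<open>v\<close> and \<open>w\<close>, so \<open>v x\<close> crosses
  \<open>u w\<close>, and the crossing gives \<open>u\<close> a vertex in the half assumed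
  empty.\<close>

lemma side_empty_next:
  assumes v: "chain_vertex v" and n: "next_vertex v z"
    and up: "a v + b v < a z + b z" "a v + b v < a w + b w" and pos: "b v < b z"
    and empty: "side_empty i j k u w"
  shows "side_empty i j k v z"
  unfolding side_empty_def
proof (intro ballI impI, rule ccontr)
  have vV: "v \<in> V" "v \<noteq> w" and vp: "0 < a v" "0 < b v" "a v * b w < a w * b v"
    using v by (auto simp: chain_vertex_def)
  have zX: "z \<in> X v" using n by (auto simp: next_vertex_def)
  note zp = X_pos[OF v zX]
  note az = next_vertex_facts[OF v n up(1)]
  fix x assume x: "x \<in> V" "x \<noteq> v" "visible S v x" "lin j (x - v) < 0" "lin k (x - v) < 0"
    "lin i (x - v) < lin i (z - v)"
    and "\<not> lin j (x - v) * lin k (z - v) \<le> lin j (z - v) * lin k (x - v)"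
  then have s: "(b x - b v) * (a z - a v) < (a x - a v) * (b z - b v)"
    unfolding lin_ab by (simp add: algebra_simps)
  have l: "a v < a x" "b v < b x" "a x + b x < a z + b z" using x unfolding lin_ab by linarith+
  have xp: "0 < a x" "0 < b x" using l vp by auto
  have xw: "a x + b x < a w + b w" using l zp(6)[OF up(2)] by linarith
  have xu: "x \<noteq> u" using xp ab_u by auto
  have rv: "a v * b x < a x * b v"
  proof -
    have "a v * (b z - b v) * (b x - b v) < b v * (a z - a v) * (b x - b v)"
      using az l by simp
    also have "\<dots> < b v * ((a x - a v) * (b z - b v))"
      using s vp by (simp add: mult.assoc mult.commute[of "a z - a v"])
    finally have "(a v * (b x - b v)) * (b z - b v) < (b v * (a x - a v)) * (b z - b v)"
      by (simp add: mult_ac)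
    then have "a v * (b x - b v) < b v * (a x - a v)" using pos by simp
    then show ?thesis by (simp add: algebra_simps)
  qed
  have rw: "a w * b x < a x * b w"
  proof (rule ccontr)
    assume nr: "\<not> a w * b x < a x * b w"
    show False
    proof (cases "(b x - b v) * (a w - a v) \<le> (a x - a v) * (b w - b v)")
      case True
      have "x \<in> convex hull {u, v, w}"
        using in_triangle_coords[OF perm _ _ vp(3) _ _ True] a_def b_def rv nr by auto
      then have "x \<in> X v" using x xu by (simp add: X_def)
      moreover have "x \<noteq> z" using l by auto
      ultimately show False using n s unfolding next_vertex_def by force
    next
      \<comment> \<open>From \<open>v\<close> the directions to \<open>x\<close>, \<open>w\<close>
        and \<open>z\<close> would be ordered cyclically although all point into the half-plane
        where \<open>a + b\<close> increases; the three-term determinant identity refutes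
        this.\<close>
      case False
      have "w \<in> X v" using wV vV ab_w ab_u by (auto simp: X_def hull_inc)
      then have "(a w - a v) * (b z - b v) \<le> (b w - b v) * (a z - a v)"
        using n unfolding next_vertex_def by (cases "w = z") (auto simp: mult.commute less_imp_le)
      then have "0 \<le> ((b w - b v) * (a z - a v) - (a w - a v) * (b z - b v)) * ((a x - a v) + (b x - b v))"
        using l by simp
      moreover have "0 < ((b x - b v) * (a w - a v) - (a x - a v) * (b w - b v)) * ((a z - a v) + (b z - b v))"
        using False up by simp
      moreover have "0 < ((a x - a v) * (b z - b v) - (b x - b v) * (a z - a v)) * ((a w - a v) + (b w - b v))"
        using s up by simp
      moreover have "((b w - b v) * (a z - a v) - (a w - a v) * (b z - b v)) * ((a x - a v) + (b x - b v)) +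
        ((b x - b v) * (a w - a v) - (a x - a v) * (b w - b v)) * ((a z - a v) + (b z - b v)) +
        ((a x - a v) * (b z - b v) - (b x - b v) * (a z - a v)) * ((a w - a v) + (b w - b v)) = 0"
        by algebra
      ultimately show False by linarith
    qed
  qed
  define Nv where "Nv = a w * b v - a v * b w"
  define Nx where "Nx = a x * b w - a w * b x"
  have N: "0 < Nv" "0 < Nx" using vp rw by (auto simp: Nv_def Nx_def)
  \<comment> \<open>\<open>Nv\<close> and \<open>Nx\<close> are proportional to the distances of
    \<open>v\<close> and \<open>x\<close> from the line \<open>u w\<close>, so this parameter gives
    its intersection with \<open>v x\<close>.\<close>
  define t where "t = Nv / (Nv + Nx)"
  have t: "0 < t" "t < 1" using N by (auto simp: t_def)
  have tN: "(1 - t) * Nv = t * Nx" using N by (simp add: t_def field_simps)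
  define y where "y = (1 - t) *\<^sub>R v + t *\<^sub>R x"
  have yu: "y - u = (1 - t) *\<^sub>R (v - u) + t *\<^sub>R (x - u)" by (simp add: y_def algebra_simps)
  have ay: "a y = (1 - t) * a v + t * a x" "b y = (1 - t) * b v + t * b x"
    unfolding a_def b_def yu by (simp_all add: lin_add lin_scale)
  have yvx: "y \<in> open_segment v x" using t x(2) by (auto simp: in_segment y_def)
  define m where "m = (a y + b y) / (a w + b w)"
  have yp: "0 < a y" "0 < b y" unfolding ay using t vp xp by (auto intro!: add_pos_pos)
  have "a y * b w = a w * b y" using tN unfolding ay Nv_def Nx_def by (simp add: algebra_simps)
  then have "m * a w = a y" "m * b w = b y" using ab_w by (simp_all add: m_def field_simps)
  then have ym: "y - u = m *\<^sub>R (w - u)"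
    by (intro lin_eqI[OF perm]) (simp_all add: lin_scale a_def b_def)
  have "a y + b y = (1 - t) * (a v + b v) + t * (a x + b x)" unfolding ay by algebra
  also have "\<dots> < (1 - t) * (a w + b w) + t * (a w + b w)"
    using add_strict_mono[OF mult_strict_left_mono[OF up(2)] mult_strict_left_mono[OF xw t(1)], of "1 - t"] t(2)
    by simp
  also have "\<dots> = a w + b w" by algebra
  finally have yw: "a y + b y < a w + b w" .
  have m: "0 < m" "m < 1" using yp ab_w yw by (auto simp: m_def)
  have "y = (1 - m) *\<^sub>R u + m *\<^sub>R w" using ym by (simp add: algebra_simps)
  moreover have "u \<noteq> w" using ab_w ab_u by auto
  ultimately have yuw: "y \<in> open_segment u w" unfolding in_segment using m by blast
  have "{u, w} \<noteq> {v, x}" using vV vp ab_u by (auto simp: doubleton_eq_iff)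
  then obtain z' where z': "z' \<in> V" "z' \<in> convex hull {u, y, x}" "z' \<noteq> u" "z' \<noteq> w"
    "visible S u z'" "same_subcone S u w z'"
    using crossing_subcone_vertex[OF uV wV vV(1) x(1) _ vis_uw x(3) yuw yvx] by blast
  obtain p q where pq: "0 \<le> p" "0 \<le> q" "p + q \<le> 1" "a z' = p * a y + q * a x" "b z' = p * b y + q * b x"
    using hull_coords[OF z'(2)] by blast
  have "a z' \<noteq> 0" "b z' \<noteq> 0" using ab_distinct[OF z'(1) uV z'(3)] ab_u by auto
  moreover have "0 \<le> a z'" "0 \<le> b z'" unfolding pq using pq yp xp by simp_all
  ultimately have zp': "0 < a z'" "0 < b z'" by auto
  have "a z' + b z' = p * (a y + b y) + q * (a x + b x)" unfolding pq by algebra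
  also have "\<dots> \<le> p * max (a y + b y) (a x + b x) + q * max (a y + b y) (a x + b x)"
    using add_mono[OF mult_left_mono[OF max.cobounded1 pq(1)] mult_left_mono[OF max.cobounded2 pq(2)]] .
  also have "\<dots> \<le> 1 * max (a y + b y) (a x + b x)"
    unfolding distrib_right[symmetric] using pq yp by (intro mult_right_mono) auto
  also have "\<dots> < a w + b w" using yw xw by simp
  finally have zw': "a z' + b z' < a w + b w" .
  have "a z' * b w - a w * b z' = p * (a y * b w - a w * b y) + q * (a x * b w - a w * b x)"
    unfolding pq by algebra
  then have "0 \<le> a z' * b w - a w * b z'"
    using \<open>a y * b w = a w * b y\<close> rw pq by simp
  moreover have "a w * b z' \<noteq> b w * a z'"
    using ab_noncollinear[OF uV wV z'(1)] z' \<open>u \<noteq> w\<close> ab_u by auto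
  ultimately have "a w * b z' < a z' * b w" by (simp add: mult.commute)
  moreover have "lin j (z' - u) * lin k (w - u) \<le> lin j (w - u) * lin k (z' - u)"
    using empty z' zp' zw' unfolding side_empty_def lin_ab ab_u by simp
  ultimately show False unfolding lin_ab ab_u by simp
qed

text \<open>Here \<open>z\<close> lies in the cone \<open>i\<close> of \<open>v\<close>, so both
  triangles share their coordinates and the route costs are differences of \<open>lcost\<close> and
  \<open>rcost\<close>.\<close>

lemma reach_next_up:
  assumes IH: smaller_short and v: "chain_vertex v" and n: "next_vertex v z"
    and up: "a v + b v < a z + b z" "a v + b v < a w + b w" and pos: "b v < b z"
  shows "reach (Ginf V S) v z (2 / sqrt 3 * max (lcost z - lcost v) (rcost z - rcost v))"
    and "side_empty i j k u w \<Longrightarrow> reach (Ginf V S) v z (2 / sqrt 3 * (lcost z - lcost v))"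
proof -
  have vV: "v \<in> V" and vp: "0 < a v" "0 < b v" using v by (auto simp: chain_vertex_def)
  have zX: "z \<in> X v" and vis: "visible S v z" using n by (auto simp: next_vertex_def)
  note zp = X_pos[OF v zX]
  note az = next_vertex_facts[OF v n up(1)]
  have sp: "short_path i j k v z"
  proof (rule smaller_shortD[OF IH perm vV zp(1) vis])
    show "lin j (z - v) < 0" "lin k (z - v) < 0" "lin i (z - v) < lin i (w - u)"
      unfolding lin_ab ab_u using az(1) pos vp zp(6)[OF up(2)] by linarith+
  qed
  then show "reach (Ginf V S) v z (2 / sqrt 3 * max (lcost z - lcost v) (rcost z - rcost v))"
    unfolding short_path_def lin_ab Let_def lcost_def rcost_def by (simp add: algebra_simps)
  show "reach (Ginf V S) v z (2 / sqrt 3 * (lcost z - lcost v))" if "side_empty i j k u w"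
    using sp side_empty_next[OF v n up pos that]
    unfolding short_path_def lin_ab Let_def lcost_def by (simp add: algebra_simps)
qed

lemma X_w: "X w = {}"
  using vertex_in_closed_segment[OF uV wV] by (auto simp: X_def segment_convex_hull)

text \<open>The clauses are the ways to charge the rest of the chain. In the second,
  \<open>lcost v\<close> has been paid and the total may end as either route. In the third, all
  remaining vertices rise faster in \<open>b\<close> than in \<open>a\<close>, so
  \<open>rcost\<close> is the larger charge throughout.\<close>

lemma reach_chain:
  assumes IH: smaller_short
  shows "v = w \<or> chain_vertex v \<Longrightarrow> \<forall>x\<in>X v. a v + b v < a x + b x \<Longrightarrow>
    (side_empty i j k u w \<longrightarrow> reach (Ginf V S) v w (2 / sqrt 3 * (lcost w - lcost v))) \<and>
    reach (Ginf V S) v w (2 / sqrt 3 * (max (lcost w) (rcost w) - lcost v)) \<and>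
    ((\<forall>x\<in>X v. a x - a v < b x - b v) \<longrightarrow>
      reach (Ginf V S) v w (2 / sqrt 3 * (rcost w - rcost v)))"
proof (induction "card (X v)" arbitrary: v rule: less_induct)
  case less
  let ?R = "reach (Ginf V S)" and ?c = "2 / sqrt 3"
  have base: "?R w w (?c * (lcost w - lcost w))" "?R w w (?c * (max (lcost w) (rcost w) - lcost w))"
    "?R w w (?c * (rcost w - rcost w))"
    by (rule reach_mono[OF reach_refl], simp)+
  show ?case
  proof (cases "v = w")
    case True
    then show ?thesis using base by blast
  next
    case False
    then have v: "chain_vertex v" using less.prems by blast
    have vV: "v \<in> V" and vp: "0 < a v" "0 < b v" using v by (auto simp: chain_vertex_def)
    have "w \<in> X v" using wV False ab_w ab_u by (auto simp: X_def hull_inc)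
    then have upw: "a v + b v < a w + b w" using less.prems by blast
    obtain z where n: "next_vertex v z" using ex_next_vertex[OF v] by blast
    then have zX: "z \<in> X v" and zc: "z = w \<or> chain_vertex z" by (auto simp: next_vertex_def)
    then have zv: "z \<noteq> v" "z \<in> V" by (auto simp: X_def)
    have upz: "a v + b v < a z + b z" using less.prems zX by blast
    note az = next_vertex_facts[OF v n upz]
    have bz: "b z \<noteq> b v" using ab_distinct zv vV by blast
    have Qz: "side_empty i j k u w \<Longrightarrow> ?R z w (?c * (lcost w - lcost z))"
      "?R z w (?c * (max (lcost w) (rcost w) - lcost z))"
      "\<forall>x\<in>X z. a x - a z < b x - b z \<Longrightarrow> ?R z w (?c * (rcost w - rcost z))"
    proof -
      have "(side_empty i j k u w \<longrightarrow> ?R z w (?c * (lcost w - lcost z))) \<and>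
        ?R z w (?c * (max (lcost w) (rcost w) - lcost z)) \<and>
        ((\<forall>x\<in>X z. a x - a z < b x - b z) \<longrightarrow> ?R z w (?c * (rcost w - rcost z)))"
      proof (cases "z = w")
        case True
        then show ?thesis using base by blast
      next
        case zw: False
        have "finite (X v)" using finite_V by (simp add: X_def)
        moreover have "X z \<subset> X v" using X_next_subset[OF v n zw] zX by blast
        ultimately have "card (X z) < card (X v)" by (rule psubset_card_mono)
        \<comment> \<open>With both coefficients 1 the functional is the height, which therefore
          keeps increasing along the chain.\<close>
        moreover have "a z + b z < a x + b x" if "x \<in> X z" for x
          using next_vertex_directions[OF v n that zw, of 1 1] upz vp az X_pos[OF v zX] by simp
        ultimately show ?thesis using less.hyps zc by blast
      qed
      then show "side_empty i j k u w \<Longrightarrow> ?R z w (?c * (lcost w - lcost z))"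
        "?R z w (?c * (max (lcost w) (rcost w) - lcost z))"
        "\<forall>x\<in>X z. a x - a z < b x - b z \<Longrightarrow> ?R z w (?c * (rcost w - rcost z))" by blast+
    qed
    have trans: "?R v w (?c * (r + s))" if "?R v z (?c * r)" "?R z w (?c * s)" for r s
      using reach_trans[OF that] by (simp add: distrib_left)
    have 1: "?R v w (?c * (lcost w - lcost v))" if e: "side_empty i j k u w"
    proof -
      have "?R v z (?c * (lcost z - lcost v))"
        using reach_next_down[OF IH v n upz upw] reach_next_up(2)[OF IH v n upz upw _ e] bz by linarith
      from trans[OF this Qz(1)[OF e]] show ?thesis by simp
    qed
    have lean: "?R v w (?c * (rcost w - rcost v)) \<and> a v < b v" if l: "a z - a v < b z - b v"
    proof -
      have pos: "b v < b z" using l az(1) by linarith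
      have "a v * (b z - b v) < b v * (b z - b v)"
        using az(2) mult_strict_left_mono[OF l vp(2)] by linarith
      then have ab: "a v < b v" using pos by simp
      have "max (lcost z - lcost v) (rcost z - rcost v) = rcost z - rcost v"
        using l by (simp add: lcost_def rcost_def)
      then have r: "?R v z (?c * (rcost z - rcost v))"
        using reach_next_up(1)[OF IH v n upz upw pos] by simp
      \<comment> \<open>The functional \<open>b - a\<close> is positive on \<open>z - u\<close> and
        \<open>z - v\<close>, hence on all later directions: the chain never leans back.\<close>
      have "a x - a z < b x - b z" if x: "x \<in> X z" for x
      proof -
        have "z \<noteq> w" using x X_w by auto
        then show ?thesis using next_vertex_directions[OF v n x, of "- 1" 1] l ab by simp
      qed
      from trans[OF r Qz(3)] this ab show ?thesis by simp
    qed
    have 2: "?R v w (?c * (max (lcost w) (rcost w) - lcost v))"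
    proof (cases "a z - a v < b z - b v")
      case True
      \<comment> \<open>The change of route is free because
        \<open>rcost v - lcost v = b v - a v\<close> is positive.\<close>
      have "rcost w - rcost v \<le> max (lcost w) (rcost w) - lcost v"
        using lean[OF True] max.cobounded2[of "rcost w" "lcost w"]
        by (simp only: lcost_def rcost_def) linarith
      then have "?c * (rcost w - rcost v) \<le> ?c * (max (lcost w) (rcost w) - lcost v)"
        by (intro mult_left_mono) auto
      then show ?thesis using lean[OF True] reach_mono by blast
    next
      case False
      have "max (lcost z - lcost v) (rcost z - rcost v) = lcost z - lcost v"
        using False by (simp add: lcost_def rcost_def)
      then have "?R v z (?c * (lcost z - lcost v))"
        using reach_next_down[OF IH v n upz upw] reach_next_up(1)[OF IH v n upz upw] bz by (metis linorder_neqE_linordered_idom)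
      from trans[OF this Qz(2)] show ?thesis by simp
    qed
    show ?thesis using 1 2 lean zX by blast
  qed
qed

text \<open>The edge \<open>u v\<close> costs at most \<open>lcost v\<close>, and the chain bounds
  start from that amount, so the costs telescope.\<close>

lemma reach_via_closest:
  assumes IH: smaller_short and e: "cone_edge i j k u v" and sub: "same_subcone S u v w"
    and left: "a v * b w < a w * b v"
  shows "reach (Ginf V S) u w (2 / sqrt 3 * max (lcost w) (rcost w))"
    and "side_empty i j k u w \<Longrightarrow> reach (Ginf V S) u w (2 / sqrt 3 * lcost w)"
proof -
  have vV: "v \<in> V" "visible S u v" and vp: "0 < a v" "0 < b v"
    using e by (auto simp: cone_edge_def a_def b_def)
  have v: "chain_vertex v" unfolding chain_vertex_def using vV vp sub left by auto
  obtain z where n: "next_vertex v z" using ex_next_vertex[OF v] by blast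
  then have zX: "z \<in> X v" and zs: "visible S u z" "same_subcone S u v z" by (auto simp: next_vertex_def)
  have zV: "z \<in> V" "z \<noteq> u" "z \<noteq> v" using zX by (auto simp: X_def)
  \<comment> \<open>Minimality of \<open>v\<close> applies to \<open>z\<close>, which
    \<open>u\<close> sees; the other vertices of \<open>X v\<close>, perhaps hidden from
    \<open>u\<close>, are higher because their directions from \<open>v\<close> lie between those of
    \<open>v - u\<close> and \<open>z - v\<close>.\<close>
  have "lin i (v - u) \<le> lin i (z - u)"
    using e zV zs X_pos(2,3)[OF v zX] unfolding cone_edge_def a_def b_def by auto
  then have upz: "a v + b v < a z + b z"
    unfolding lin_ab using ab_distinct(3)[OF zV(1) vV(1) zV(3)] by linarith
  have "a v + b v < a x + b x" if x: "x \<in> X v" for x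
  proof (cases "x = z")
    case False
    have 1: "a v * (b z - b v) < b v * (a z - a v)" using next_vertex_facts[OF v n upz] by blast
    have 2: "a v * (b x - b v) < b v * (a x - a v)" using X_pos(4)[OF v x] by (simp add: algebra_simps)
    have 3: "(a x - a v) * (b z - b v) < (b x - b v) * (a z - a v)"
      using n x False by (simp add: next_vertex_def)
    show ?thesis using between_directions[OF 1 2 3, of 1 1] vp upz by simp
  qed (use upz in simp)
  note chain = reach_chain[OF IH, of v] v this
  have uv: "reach (Ginf V S) u v (2 / sqrt 3 * lcost v)"
  proof -
    have "(u, v) \<in> Ginf V S" using e Ginf_iff by blast
    then have "reach (Ginf V S) u v (dist u v)" by (intro reach_edge) (simp add: adj_def)
    moreover have "dist u v \<le> 2 / sqrt 3 * lcost v"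
      using norm_le_cost[OF perm, of "v - u"] vp
      by (simp add: dist_norm norm_minus_commute lcost_def a_def b_def)
    ultimately show ?thesis by (rule reach_mono)
  qed
  have trans: "reach (Ginf V S) u w (2 / sqrt 3 * r)"
    if "reach (Ginf V S) v w (2 / sqrt 3 * (r - lcost v))" for r
    using reach_trans[OF uv that] by (simp add: distrib_left[symmetric] del: times_divide_eq_left)
  show "reach (Ginf V S) u w (2 / sqrt 3 * max (lcost w) (rcost w))"
    using chain by (intro trans) blast
  show "side_empty i j k u w \<Longrightarrow> reach (Ginf V S) u w (2 / sqrt 3 * lcost w)"
    using chain by (intro trans) blast
qed

end

section \<open>Induction over equilateral triangles\<close>

context obstacle_setting
begin

text \<open>For a pair in a positive cone this is the height of its equilateral triangle; being
  symmetric in the functionals, it compares pairs from different cones.\<close>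

definition extent :: "pt \<times> pt \<Rightarrow> real" where
  "extent e = max \<bar>lin 0 (snd e - fst e)\<bar> (max \<bar>lin 1 (snd e - fst e)\<bar> \<bar>lin 2 (snd e - fst e)\<bar>)"

lemma extent_cone:
  assumes "perm3 i j k" "lin j (w - u) < 0" "lin k (w - u) < 0"
  shows "extent (u, w) = lin i (w - u)"
proof -
  have "extent (u, w) = max \<bar>lin i (w - u)\<bar> (max \<bar>lin j (w - u)\<bar> \<bar>lin k (w - u)\<bar>)"
    by (rule perm3_cases[OF assms(1)]) (auto simp: extent_def max_def)
  then show ?thesis using lin_sum[OF assms(1), of "w - u"] assms(2,3) by auto
qed

text \<open>The minimum is taken over the subcone of \<open>w\<close>, whereas an edge must be
  minimal in the subcone of its own endpoint; transitivity identifies the two.\<close>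

lemma ex_closest:
  assumes p: "perm3 i j k" and V: "u \<in> V" "w \<in> V" and vis: "visible S u w"
    and neg: "lin j (w - u) < 0" "lin k (w - u) < 0"
  obtains v where "cone_edge i j k u v" "same_subcone S u v w" "lin i (v - u) \<le> lin i (w - u)"
proof -
  define Z where "Z = {z \<in> V. z \<noteq> u \<and> visible S u z \<and> same_subcone S u w z \<and>
    lin j (z - u) < 0 \<and> lin k (z - u) < 0}"
  have wu: "w \<noteq> u" using neg by (auto simp: lin_def)
  then have wZ: "w \<in> Z" unfolding Z_def using V vis neg same_subcone_refl by blast
  have "finite Z" using finite_V by (simp add: Z_def)
  then have "\<exists>v\<in>Z. \<forall>z\<in>Z. lin i (v - u) \<le> lin i (z - u)"
    using wZ ex_min_if_finite[of "(\<lambda>z. lin i (z - u)) ` Z"] by (auto simp: not_less)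
  then obtain v where vZ: "v \<in> Z" and vmin: "\<And>z. z \<in> Z \<Longrightarrow> lin i (v - u) \<le> lin i (z - u)"
    by blast
  have v: "v \<in> V" "v \<noteq> u" "visible S u v" "same_subcone S u w v" "lin j (v - u) < 0" "lin k (v - u) < 0"
    using vZ by (auto simp: Z_def)
  have "lin i (v - u) \<le> lin i (z - u)"
    if z: "z \<in> V" "z \<noteq> u" "visible S u z" "same_subcone S u v z" "lin j (z - u) < 0" "lin k (z - u) < 0" for z
  proof -
    have "same_subcone S u w z"
    proof (cases "w = z")
      case True
      then show ?thesis using same_subcone_refl[OF vis] by simp
    next
      case False
      have "0 < lin i (w - u)" "0 < lin i (v - u)" "0 < lin i (z - u)"
        using lin_sum[OF p] neg v(5,6) z(5,6) by (smt (verit))+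
      then have "sector u w z \<subseteq> sector u w v \<union> sector u v z"
        using cross2_vertices[of u w z] V wu z False by (intro sector_subset_Un) auto
      then show ?thesis using same_subcone_trans[OF v(4) z(4)] by blast
    qed
    then show ?thesis using z by (intro vmin) (simp add: Z_def)
  qed
  then have "cone_edge i j k u v"
    unfolding cone_edge_def using p V v by blast
  then show ?thesis using that vmin[OF wZ] same_subcone_sym[OF v(4)] by blast
qed

text \<open>Only finitely many vertex pairs have smaller \<open>extent\<close>, so their number is
  the induction measure.\<close>

lemma short_path_visible:
  "perm3 i j k \<Longrightarrow> u \<in> V \<Longrightarrow> w \<in> V \<Longrightarrow> visible S u w \<Longrightarrow> lin j (w - u) < 0 \<Longrightarrow> lin k (w - u) < 0 \<Longrightarrow>
    short_path i j k u w"
proof (induction "card {e \<in> V \<times> V. extent e < extent (u, w)}" arbitrary: i j k u w rule: less_induct)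
  case less
  note pr = less.prems
  have pr': "perm3 i k j" using perm3_swap(1)[OF pr(1)] .
  interpret cp: cone_pair V S i j k u w by unfold_locales (fact pr)+
  \<comment> \<open>The mirror image, in which \<open>a\<close> and \<open>b\<close> trade places;
    it serves the case of \<open>v\<close> on the other side of \<open>u w\<close>.\<close>
  interpret sw: cone_pair V S i k j u w by unfold_locales (fact pr pr')+
  have IH: "short_path i' j' k' p q"
    if h: "perm3 i' j' k'" "p \<in> V" "q \<in> V" "visible S p q" "lin j' (q - p) < 0" "lin k' (q - p) < 0"
      "lin i' (q - p) < lin i (w - u)" for i' j' k' p q
  proof -
    have ext: "extent (p, q) < extent (u, w)"
      using extent_cone[OF h(1,5,6)] extent_cone[OF pr(1,5,6)] h(7) by simp
    have "{e \<in> V \<times> V. extent e < extent (p, q)} \<subset> {e \<in> V \<times> V. extent e < extent (u, w)}"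
      using ext h(2,3) by (intro psubsetI) auto
    then have "card {e \<in> V \<times> V. extent e < extent (p, q)} < card {e \<in> V \<times> V. extent e < extent (u, w)}"
      using finite_V by (intro psubset_card_mono) auto
    then show ?thesis using less.hyps h by blast
  qed
  have sm: "cp.smaller_short" "sw.smaller_short"
    unfolding cp.smaller_short_def sw.smaller_short_def using IH by blast+
  have sw: "sw.a = cp.b" "sw.b = cp.a"
    by (auto simp: sw.a_def sw.b_def cp.a_def cp.b_def)
  obtain v where v: "cone_edge i j k u v" "same_subcone S u v w" "lin i (v - u) \<le> lin i (w - u)"
    using ex_closest[OF pr] by blast
  have vV: "v \<in> V" "u \<noteq> v" "visible S u v" "lin j (v - u) < 0" "lin k (v - u) < 0"
    using v(1) by (auto simp: cone_edge_def)
  have goal: "short_path i j k u w \<longleftrightarrow>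
     reach (Ginf V S) u w (2 / sqrt 3 * max (cp.lcost w) (cp.rcost w)) \<and>
     (side_empty i j k u w \<longrightarrow> reach (Ginf V S) u w (2 / sqrt 3 * cp.lcost w)) \<and>
     (side_empty i k j u w \<longrightarrow> reach (Ginf V S) u w (2 / sqrt 3 * cp.rcost w))"
    unfolding short_path_def Let_def cp.lcost_def cp.rcost_def cp.a_def cp.b_def ..
  show ?case
  proof (cases "v = w")
    case True
    have "(u, w) \<in> Ginf V S" using v(1) True Ginf_iff by blast
    then have r: "reach (Ginf V S) u w (dist u w)" by (intro reach_edge) (simp add: adj_def)
    have "dist u w \<le> 2 / sqrt 3 * cp.lcost w"
      using norm_le_cost[OF pr(1), of "w - u"] pr(5,6)
      by (simp add: dist_norm norm_minus_commute cp.lcost_def cp.a_def cp.b_def)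
    moreover have "dist u w \<le> 2 / sqrt 3 * cp.rcost w"
      using norm_le_cost[OF perm3_swap(1)[OF pr(1)], of "w - u"] pr(5,6)
      by (simp add: dist_norm norm_minus_commute cp.rcost_def cp.a_def cp.b_def algebra_simps)
    moreover have "2 / sqrt 3 * cp.lcost w \<le> 2 / sqrt 3 * max (cp.lcost w) (cp.rcost w)"
      by (intro mult_left_mono) auto
    ultimately show ?thesis unfolding goal using reach_mono[OF r] by (meson order_trans)
  next
    case False
    have uw: "u \<noteq> w" using pr(5) by (auto simp: lin_def)
    have "lin i v \<noteq> lin i w"
      using lin_vertices[OF perm3_less(1)[OF pr(1)] vV(1) pr(3) False] by (simp add: lin_diff)
    then have lt: "lin i (v - u) < lin i (w - u)" using v(3) by (simp add: lin_diff)
    have vp: "0 < cp.a v" "0 < cp.b v" using vV by (simp_all add: cp.a_def cp.b_def)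
    have "cp.a v * cp.b w \<noteq> cp.a w * cp.b v"
      using cp.ab_noncollinear[OF pr(2) vV(1) pr(3) vV(2) uw False] by (simp add: cp.ab_u mult.commute)
    then consider (left) "cp.a v * cp.b w < cp.a w * cp.b v" | (right) "cp.a w * cp.b v < cp.a v * cp.b w" by linarith
    then show ?thesis
    proof cases
      case left
      \<comment> \<open>The closest vertex itself occupies this half, so the corresponding clause
        holds vacuously.\<close>
      have "\<not> side_empty i k j u w"
        unfolding side_empty_def using vV same_subcone_sym[OF v(2)] lt left
        by (auto simp: cp.lin_ab cp.ab_u not_le mult.commute intro!: bexI[of _ v])
      then show ?thesis
        unfolding goal using cp.reach_via_closest[OF sm(1) v(1,2) left] by blast
    next
      case right
      have "\<not> side_empty i j k u w"
        unfolding side_empty_def using vV same_subcone_sym[OF v(2)] lt right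
        by (auto simp: cp.lin_ab cp.ab_u not_le mult.commute intro!: bexI[of _ v])
      moreover have "sw.a v * sw.b w < sw.a w * sw.b v" using right by (simp add: sw mult.commute)
      moreover have "sw.lcost w = cp.rcost w" "sw.rcost w = cp.lcost w"
        by (simp_all add: sw.lcost_def sw.rcost_def cp.lcost_def cp.rcost_def sw)
      ultimately show ?thesis
        unfolding goal using sw.reach_via_closest[OF sm(2) cone_edge_swap[OF v(1)] v(2)]
        by (simp add: max.commute)
    qed
  qed
qed

text \<open>Of three nonzero numbers with sum zero, two have the same sign. Hence one endpoint lies
  in a positive cone of the other, and symmetry of \<open>reach\<close> covers the reversed
  case.\<close>

lemma reach_visible:
  assumes V: "x \<in> V" "y \<in> V" "x \<noteq> y" and vis: "visible S x y"
  shows "reach (Ginf V S) x y (2 * dist x y)"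
proof -
  have main: "reach (Ginf V S) p q (2 * dist p q)"
    if "perm3 i j k" "p \<in> V" "q \<in> V" "visible S p q" "lin j (q - p) < 0" "lin k (q - p) < 0" for i j k p q
  proof -
    have "reach (Ginf V S) p q (2 / sqrt 3 * max (2 * - lin j (q - p) + - lin k (q - p)) (- lin j (q - p) + 2 * - lin k (q - p)))"
      using short_path_visible[OF that] unfolding short_path_def Let_def by blast
    moreover have "2 / sqrt 3 * max (2 * - lin j (q - p) + - lin k (q - p)) (- lin j (q - p) + 2 * - lin k (q - p)) \<le> 2 * dist p q"
      using cost_le_norm[OF that(1), of "q - p"] by (simp add: dist_norm norm_minus_commute)
    ultimately show ?thesis by (rule reach_mono)
  qed
  have vis': "visible S y x" using vis by (simp add: visible_def closed_segment_commute)
  let ?l = "\<lambda>i. lin i (y - x)"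
  have l: "lin i (x - y) = - ?l i" for i by (simp add: lin_diff)
  have perms: "perm3 0 1 2" "perm3 1 0 2" "perm3 2 0 1" by (auto simp: perm3_def)
  have "?l 0 = - ?l 1 - ?l 2" using lin_sum[OF perms(1)] .
  moreover have "?l 0 \<noteq> 0" "?l 1 \<noteq> 0" "?l 2 \<noteq> 0" using lin_vertices[OF _ V] by simp_all
  ultimately consider "?l 1 < 0" "?l 2 < 0" | "?l 0 < 0" "?l 2 < 0" | "?l 0 < 0" "?l 1 < 0"
    | "?l 1 > 0" "?l 2 > 0" | "?l 0 > 0" "?l 2 > 0" | "?l 0 > 0" "?l 1 > 0" by linarith
  then show ?thesis
  proof cases
    case 4
    then have "reach (Ginf V S) y x (2 * dist y x)" using main[OF perms(1) V(2,1) vis'] l by simp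
    then show ?thesis using reach_sym by (simp add: dist_commute)
  next
    case 5
    then have "reach (Ginf V S) y x (2 * dist y x)" using main[OF perms(2) V(2,1) vis'] l by simp
    then show ?thesis using reach_sym by (simp add: dist_commute)
  next
    case 6
    then have "reach (Ginf V S) y x (2 * dist y x)" using main[OF perms(3) V(2,1) vis'] l by simp
    then show ?thesis using reach_sym by (simp add: dist_commute)
  qed (use main[OF _ V(1,2) vis] perms in blast)+
qed

end

theorem theorem4:
  assumes "valid_setting V S"
    and "general_position V"
  shows "plane (Ginf V S) \<and> is_spanner 2 V (Ginf V S) (Vis V S)"
proof -
  interpret obstacle_setting V S
    using assms by unfold_locales
  have "is_spanner 2 V (Ginf V S) (Vis V S)"
    by (rule is_spannerI[OF Ginf_subset_Vis]) (auto simp: Vis_def intro: reach_visible)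
  then show ?thesis
    using plane_Ginf by blast
qed

end
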